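(* Let $K$ be a finite extension of $F$ of degree $r$, let $U$ be a compact open subset of $K$ and let $f : U \to K$ be a strictly differentiable function such that $(f(x), f'(x)) \neq (0,0)$ for all $x \in U$. Then $$\#f^{-1}(0) = \lim_{s\to\infty} q^{sr}\int_U \|f'(x)\|^r\cdot \mathbb{1}_{\{\|f(x)\|\leq q^{-s}\}}\, dx.$$
   Context: Let $p$ be a prime and $F$ a finite extension of $\mathbb{Q}_p$ whose residue field has cardinality $q$. Let $\|\cdot\|$ be the absolute value on an algebraic closure of $F$ normalized by $\|p\| = p^{-[F:\mathbb{Q}_p]}$. For a finite extension $K$ of $F$, $dx$ denotes the Haar measure $\lambda_K$ on $K$ normalized by $\lambda_K(\mathcal{O}_K)=1$. A function $f:U\to K$ is strictly differentiable if for every $a\in U$ the quotient $\frac{f(x)-f(y)}{x-y}$ tends to a limit $f'(a)$ as $(x,y)\to(a,a)$ with $x\neq y$. *)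

theory Defs
  imports "HOL-Analysis.Analysis" "HOL-Algebra.Algebraic_Closure_Type"
begin

text \<open>
  Everything lives inside one ambient field with an absolute value, which the theorem takes to
  be an algebraic closure of \<open>F\<close>. Since \<open>absv x = dist x 0\<close>, definiteness and the triangle
  inequality of the absolute value come from the metric axioms, and the topology of the type is
  the one defined by the absolute value.
\<close>

class abs_valued_field = field_char_0 + metric_space +
  fixes absv :: "'a \<Rightarrow> real"
  assumes dist_absv: "dist x y = absv (x - y)"
    and absv_mult: "absv (x * y) = absv x * absv y"

abbreviation ambient :: "'a::abs_valued_field ring" where
  "ambient \<equiv> ring_of_type_algebra"

definition finite_extension_degree :: "'a::abs_valued_field set \<Rightarrow> 'a set \<Rightarrow> nat \<Rightarrow> bool" where
  "finite_extension_degree F K n \<longleftrightarrow>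
     subfield F ambient \<and> subfield K ambient \<and> F \<subseteq> K \<and> ring.dimension ambient n F K"

definition padic_abs :: "nat \<Rightarrow> rat \<Rightarrow> real" where
  "padic_abs p x =
     (if x = 0 then 0
      else real p powi (int (multiplicity (int p) (snd (quotient_of x)))
                        - int (multiplicity (int p) (fst (quotient_of x)))))"

text \<open>
  \<open>Q\<close> is a copy of the field of \<open>p\<close>-adic numbers: a completion of the rationals for the
  \<open>p\<close>-adic absolute value. The ambient absolute value is only required to restrict to a positive
  power of the \<open>p\<close>-adic one, because its normalisation depends on \<open>F\<close>.
\<close>

definition padic_numbers :: "nat \<Rightarrow> 'a::abs_valued_field set \<Rightarrow> bool" where
  "padic_numbers p Q \<longleftrightarrow>
     subfield Q ambient \<and> complete Q \<and> Q = closure \<rat> \<and>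
     (\<exists>c>0. \<forall>x. absv (of_rat x :: 'a) = padic_abs p x powr c)"

definition integer_ring :: "'a::abs_valued_field set \<Rightarrow> 'a set" where
  "integer_ring K = {x \<in> K. absv x \<le> 1}"

definition maximal_ideal :: "'a::abs_valued_field set \<Rightarrow> 'a set" where
  "maximal_ideal K = {x \<in> K. absv x < 1}"

definition residue_field :: "'a::abs_valued_field set \<Rightarrow> 'a set ring" where
  "residue_field K = (ambient\<lparr>carrier := integer_ring K\<rparr>) Quot (maximal_ideal K)"

text \<open>
  No regularity condition is imposed: a finite extension of the \<open>p\<close>-adic numbers is locally
  compact and second countable, so finiteness on compact sets already implies regularity.
\<close>

definition haar_measure_on :: "'a::abs_valued_field set \<Rightarrow> 'a measure \<Rightarrow> bool" where
  "haar_measure_on K M \<longleftrightarrow>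
     sets M = sets (restrict_space borel K) \<and>
     emeasure M K \<noteq> 0 \<and>
     (\<forall>C. compact C \<and> C \<subseteq> K \<longrightarrow> emeasure M C < \<infinity>) \<and>
     (\<forall>a\<in>K. \<forall>A\<in>sets M. emeasure M ((+) a ` A) = emeasure M A)"

definition has_strict_derivative_on ::
  "('a::abs_valued_field \<Rightarrow> 'a) \<Rightarrow> ('a \<Rightarrow> 'a) \<Rightarrow> 'a set \<Rightarrow> bool" where
  "has_strict_derivative_on f f' U \<longleftrightarrow>
     (\<forall>a\<in>U. ((\<lambda>(x, y). (f x - f y) / (x - y)) \<longlongrightarrow> f' a)
              (at (a, a) within {(x, y). x \<in> U \<and> y \<in> U \<and> x \<noteq> y}))"

end

theory Submission
  imports Defs "HOL-Number_Theory.Cong"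
begin

text \<open>
  Counting residue classes modulo \<open>p\<close> shows that a uniformizer of \<open>F\<close> has absolute value \<open>1 / q\<close>
  and that the disc of radius \<open>absv b\<close> in \<open>K\<close> has Haar measure \<open>absv b ^ r\<close>. Near a zero \<open>a\<close> the
  ultrametric inequality makes \<open>absv (f x)\<close> equal to \<open>absv (f' a) * dist x a\<close> and makes \<open>absv \<circ> f'\<close>
  constant, so for large \<open>s\<close> the condition \<open>absv (f x) \<le> q ^ -s\<close> cuts out near \<open>a\<close> a disc of measure
  \<open>(q ^ -s / absv (f' a)) ^ r\<close>, which contributes exactly \<open>1\<close>. By compactness \<open>f\<close> is bounded away
  from \<open>0\<close> elsewhere, so the sequence is eventually constant.
\<close>

section \<open>The absolute value and its topology\<close>

lemma absv_conv_dist: "absv x = dist x (0 :: 'a::abs_valued_field)"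
  by (simp add: dist_absv)

lemma absv_nonneg [simp]: "absv (x :: 'a::abs_valued_field) \<ge> 0"
  by (simp add: absv_conv_dist)

lemma absv_eq_0_iff [simp]: "absv (x :: 'a::abs_valued_field) = 0 \<longleftrightarrow> x = 0"
  by (simp add: absv_conv_dist)

lemma absv_0 [simp]: "absv (0 :: 'a::abs_valued_field) = 0"
  by simp

lemma absv_pos_iff [simp]: "absv (x :: 'a::abs_valued_field) > 0 \<longleftrightarrow> x \<noteq> 0"
  by (simp add: absv_conv_dist)

lemma absv_le_0_iff [simp]: "absv (x :: 'a::abs_valued_field) \<le> 0 \<longleftrightarrow> x = 0"
  by (simp add: absv_conv_dist)

lemma absv_1 [simp]: "absv (1 :: 'a::abs_valued_field) = 1"
  using absv_mult[of "1::'a" 1] by simp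

lemma absv_uminus [simp]: "absv (- x :: 'a::abs_valued_field) = absv x"
  using dist_commute[of 0 x] by (simp add: dist_absv)

lemma absv_triangle: "absv (x + y :: 'a::abs_valued_field) \<le> absv x + absv y"
  using dist_triangle[of x "-y" 0] by (simp add: dist_absv)

lemma absv_power: "absv (x ^ n :: 'a::abs_valued_field) = absv x ^ n"
  by (induction n) (simp_all add: absv_mult)

lemma absv_inverse: "absv (inverse x :: 'a::abs_valued_field) = inverse (absv x)"
proof (cases "x = 0")
  case False
  then have "absv x * absv (inverse x) = 1"
    by (simp flip: absv_mult)
  then show ?thesis by (metis inverse_unique)
qed simp

lemma absv_divide: "absv (x / y :: 'a::abs_valued_field) = absv x / absv y"
  by (simp add: divide_inverse absv_mult absv_inverse)

lemma absv_sum_le_sum: "absv (sum g I :: 'a::abs_valued_field) \<le> (\<Sum>i\<in>I. absv (g i))"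
proof (induction I rule: infinite_finite_induct)
  case (insert i I)
  then show ?case using absv_triangle[of "g i" "sum g I"] by simp
qed simp_all



lemma tendsto_absv [tendsto_intros]:
  "(f \<longlongrightarrow> (a :: 'a::abs_valued_field)) F \<Longrightarrow> ((\<lambda>x. absv (f x)) \<longlongrightarrow> absv a) F"
  unfolding absv_conv_dist by (intro tendsto_intros)

lemma continuous_on_absv [continuous_intros]:
  "continuous_on S (f :: _ \<Rightarrow> 'a::abs_valued_field) \<Longrightarrow> continuous_on S (\<lambda>x. absv (f x))"
  unfolding absv_conv_dist by (intro continuous_intros)

instance abs_valued_field < topological_ab_group_add
proof
  fix a b :: 'a
  show "((\<lambda>z. fst z + snd z) \<longlongrightarrow> a + b) (nhds a \<times>\<^sub>F nhds b)"
  proof (rule metric_tendsto_imp_tendsto)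
    show "((\<lambda>z. dist (fst z) a + dist (snd z) b) \<longlongrightarrow> 0) (nhds a \<times>\<^sub>F nhds b)"
      unfolding nhds_prod[symmetric] by (auto intro!: tendsto_eq_intros filterlim_ident)
    have "dist (x + y) (a + b) \<le> dist x a + dist y b" for x y
      using absv_triangle[of "x - a" "y - b"] by (simp add: dist_absv algebra_simps)
    then show "\<forall>\<^sub>F z in nhds a \<times>\<^sub>F nhds b.
        dist (fst z + snd z) (a + b) \<le> dist (dist (fst z) a + dist (snd z) b) 0"
      by simp
  qed
  show "(uminus \<longlongrightarrow> - a) (nhds a)"
  proof (rule metric_tendsto_imp_tendsto[OF filterlim_ident])
    have "dist (- x) (- a) = dist x a" for x
      using absv_uminus[of "x - a"] by (simp add: dist_absv del: absv_uminus)
    then show "\<forall>\<^sub>F x in nhds a. dist (- x) (- a) \<le> dist x a"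
      by simp
  qed
qed

instance abs_valued_field < topological_semigroup_mult
proof
  fix a b :: 'a
  show "((\<lambda>z. fst z * snd z) \<longlongrightarrow> a * b) (nhds a \<times>\<^sub>F nhds b)"
  proof (rule metric_tendsto_imp_tendsto)
    show "((\<lambda>z. absv (fst z) * dist (snd z) b + dist (fst z) a * absv b) \<longlongrightarrow> 0)
        (nhds a \<times>\<^sub>F nhds b)"
      unfolding nhds_prod[symmetric] by (auto intro!: tendsto_eq_intros filterlim_ident)
    have "dist (x * y) (a * b) \<le> absv x * dist y b + dist x a * absv b" for x y
      using absv_triangle[of "x * (y - b)" "(x - a) * b"]
      by (simp add: dist_absv algebra_simps flip: absv_mult)
    then show "\<forall>\<^sub>F z in nhds a \<times>\<^sub>F nhds b. dist (fst z * snd z) (a * b)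
        \<le> dist (absv (fst z) * dist (snd z) b + dist (fst z) a * absv b) 0"
      by simp
  qed
qed

lemma absv_add_power_le:
  fixes x y :: "'a::abs_valued_field"
  assumes of_nat_le_1: "\<And>n. absv (of_nat n :: 'a) \<le> 1"
  shows "absv (x + y) ^ n \<le> real (Suc n) * max (absv x) (absv y) ^ n"
proof -
  define M where "M = max (absv x) (absv y)"
  have summand_le: "absv (of_nat (n choose k) * x ^ k * y ^ (n - k)) \<le> M ^ n" if "k \<le> n" for k
  proof -
    have "absv (of_nat (n choose k) :: 'a) * (absv x ^ k * absv y ^ (n - k))
        \<le> 1 * (M ^ k * M ^ (n - k))"
      using of_nat_le_1 by (intro mult_mono power_mono) (auto simp: M_def le_max_iff_disj)
    also have "\<dots> = M ^ n" using that by (simp flip: power_add)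
    finally show ?thesis by (simp add: absv_mult absv_power mult.assoc)
  qed
  have "absv (x + y) ^ n = absv (\<Sum>k\<le>n. of_nat (n choose k) * x ^ k * y ^ (n - k))"
    by (simp only: absv_power[symmetric] binomial_ring)
  also have "\<dots> \<le> (\<Sum>k\<le>n. absv (of_nat (n choose k) * x ^ k * y ^ (n - k)))"
    by (rule absv_sum_le_sum)
  also have "\<dots> \<le> (\<Sum>k\<le>n. M ^ n)"
    using summand_le by (intro sum_mono) simp
  finally show ?thesis by (simp add: M_def)
qed

lemma absv_add_le_max_if_of_nat_le_1:
  fixes x y :: "'a::abs_valued_field"
  assumes of_nat_le_1: "\<And>n. absv (of_nat n :: 'a) \<le> 1"
  shows "absv (x + y) \<le> max (absv x) (absv y)"
proof (rule ccontr)
  assume "\<not> ?thesis"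
  then have max_less: "max (absv x) (absv y) < absv (x + y)" by (simp only: not_le)
  then have sum_pos: "absv (x + y) > 0"
    using absv_nonneg[of x] by linarith
  define t where "t = max (absv x) (absv y) / absv (x + y)"
  have "0 \<le> t" "t < 1"
    using max_less sum_pos by (auto simp: t_def le_max_iff_disj)
  then have "(\<lambda>n. real n * t ^ n + t ^ n) \<longlonglongrightarrow> 0 + 0"
    by (intro tendsto_add powser_times_n_limit_0 LIMSEQ_power_zero) auto
  moreover have "real n * t ^ n + t ^ n \<ge> 1" for n
    using absv_add_power_le[OF of_nat_le_1, of x y n] sum_pos
    by (simp add: t_def power_divide field_simps)
  ultimately have "(1::real) \<le> 0 + 0"
    by (intro LIMSEQ_le_const) auto
  then show False by simp
qed

section \<open>Strict derivatives\<close>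

lemma has_strict_derivative_onE:
  assumes "has_strict_derivative_on f f' U" "a \<in> U" "e > 0"
  obtains \<delta> where "\<delta> > 0"
    "\<And>x y. \<lbrakk>x \<in> U; y \<in> U; x \<noteq> y; dist x a < \<delta>; dist y a < \<delta>\<rbrakk> \<Longrightarrow>
      dist ((f x - f y) / (x - y)) (f' a) < e"
proof -
  define S where "S = {(x, y). x \<in> U \<and> y \<in> U \<and> x \<noteq> y}"
  have "\<forall>\<^sub>F z in at (a, a) within S. dist (case z of (x, y) \<Rightarrow> (f x - f y) / (x - y)) (f' a) < e"
    using assms unfolding has_strict_derivative_on_def S_def by (intro tendstoD) auto
  then obtain \<delta> where "\<delta> > 0"
    and slope_near: "\<And>z. \<lbrakk>z \<in> S; z \<noteq> (a, a); dist z (a, a) < \<delta>\<rbrakk> \<Longrightarrow>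
      dist (case z of (x, y) \<Rightarrow> (f x - f y) / (x - y)) (f' a) < e"
    unfolding eventually_at by blast
  show thesis
  proof (rule that)
    show "\<delta> / 2 > 0" using \<open>\<delta> > 0\<close> by simp
    fix x y assume points_near: "x \<in> U" "y \<in> U" "x \<noteq> y" "dist x a < \<delta> / 2" "dist y a < \<delta> / 2"
    have "dist (x, y) (a, a) \<le> dist x a + dist y a"
      unfolding dist_prod_def by (simp add: sqrt_sum_squares_le_sum)
    then show "dist ((f x - f y) / (x - y)) (f' a) < e"
      using slope_near[of "(x, y)"] points_near by (auto simp: S_def)
  qed
qed

lemma has_strict_derivative_on_imp_tendsto_slope:
  assumes deriv: "has_strict_derivative_on f f' U" and a_in_U: "a \<in> U"
  shows "((\<lambda>x. (f x - f a) / (x - a)) \<longlongrightarrow> f' a) (at a within U)"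
proof (rule tendstoI)
  fix e :: real assume "e > 0"
  then obtain \<delta> where "\<delta> > 0" "\<And>x y. \<lbrakk>x \<in> U; y \<in> U; x \<noteq> y; dist x a < \<delta>; dist y a < \<delta>\<rbrakk> \<Longrightarrow>
      dist ((f x - f y) / (x - y)) (f' a) < e"
    using has_strict_derivative_onE[OF deriv a_in_U] by metis
  then show "\<forall>\<^sub>F x in at a within U. dist ((f x - f a) / (x - a)) (f' a) < e"
    using a_in_U by (auto simp: eventually_at)
qed

lemma has_strict_derivative_on_imp_continuous_on:
  assumes deriv: "has_strict_derivative_on f f' U"
  shows "continuous_on U f"
  unfolding continuous_on
proof
  fix a assume a_in_U: "a \<in> U"
  have "((\<lambda>x. f a + (f x - f a) / (x - a) * (x - a)) \<longlongrightarrow> f a + f' a * (a - a)) (at a within U)"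
    by (intro tendsto_intros has_strict_derivative_on_imp_tendsto_slope[OF deriv a_in_U])
  then show "(f \<longlongrightarrow> f a) (at a within U)"
    by (rule Lim_transform_eventually[THEN tendsto_eq_rhs])
      (auto simp: eventually_at_filter)
qed

lemma has_strict_derivative_on_imp_continuous_on_derivative:
  assumes deriv: "has_strict_derivative_on f f' U"
    and not_isolated: "\<And>a. a \<in> U \<Longrightarrow> at a within U \<noteq> bot"
  shows "continuous_on U f'"
  unfolding continuous_on
proof (intro ballI tendstoI)
  fix a and e :: real assume a_in_U: "a \<in> U" and "e > 0"
  then obtain \<delta> where "\<delta> > 0"
    and slope_near: "\<And>x y. \<lbrakk>x \<in> U; y \<in> U; x \<noteq> y; dist x a < \<delta>; dist y a < \<delta>\<rbrakk> \<Longrightarrow>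
      dist ((f x - f y) / (x - y)) (f' a) < e / 2"
    using has_strict_derivative_onE[OF deriv a_in_U, of "e / 2"] by auto
  have "dist (f' x) (f' a) < e" if x_near: "x \<in> U" "dist x a < \<delta>" for x
  proof -
    have "\<forall>\<^sub>F y in at x within U. dist y a < \<delta>"
      using x_near(2) by (intro order_tendstoD(2)[of _ "dist x a"] tendsto_intros)
    moreover have "\<forall>\<^sub>F y in at x within U. y \<in> U \<and> y \<noteq> x"
      by (simp add: eventually_at_filter)
    ultimately have "\<forall>\<^sub>F y in at x within U. dist ((f y - f x) / (y - x)) (f' a) \<le> e / 2"
      by eventually_elim (use slope_near x_near in \<open>auto intro: less_imp_le\<close>)
    moreover have "((\<lambda>y. dist ((f y - f x) / (y - x)) (f' a)) \<longlongrightarrow> dist (f' x) (f' a)) (at x within U)"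
      by (intro tendsto_intros has_strict_derivative_on_imp_tendsto_slope[OF deriv x_near(1)])
    ultimately have "dist (f' x) (f' a) \<le> e / 2"
      using not_isolated[OF x_near(1)] by (intro tendsto_upperbound)
    then show ?thesis using \<open>e > 0\<close> by simp
  qed
  then show "\<forall>\<^sub>F x in at a within U. dist (f' x) (f' a) < e"
    using \<open>\<delta> > 0\<close> by (auto simp: eventually_at)
qed

section \<open>Subfields of the ambient field\<close>

lemma ambient_simps [simp]:
  "carrier (ambient :: 'a::abs_valued_field ring) = UNIV"
  "x \<otimes>\<^bsub>(ambient :: 'a ring)\<^esub> y = x * y"
  "x \<oplus>\<^bsub>(ambient :: 'a ring)\<^esub> y = x + y"
  "\<one>\<^bsub>(ambient :: 'a ring)\<^esub> = 1"
  "\<zero>\<^bsub>(ambient :: 'a ring)\<^esub> = 0"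
  by (simp_all add: ring_of_type_algebra_def)

lemma ambient_a_inv [simp]: "\<ominus>\<^bsub>(ambient :: 'a::abs_valued_field ring)\<^esub> x = - x"
proof -
  interpret R: ring "ambient :: 'a ring" by rule
  show ?thesis by (rule R.minus_equality) auto
qed

lemma ambient_m_inv:
  assumes "x \<noteq> 0"
  shows "inv\<^bsub>(ambient :: 'a::abs_valued_field ring)\<^esub> x = inverse x"
proof -
  interpret R: field "ambient :: 'a ring" by rule
  show ?thesis using assms by (intro R.comm_inv_char) auto
qed

context
  fixes K :: "'a::abs_valued_field set"
  assumes subfield_K: "subfield K ambient"
begin

lemma subfield_zero: "0 \<in> K"
  using subringE(2)[OF subfieldE(1)[OF subfield_K]] by simp

lemma subfield_one: "1 \<in> K"
  using subringE(3)[OF subfieldE(1)[OF subfield_K]] by simp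

lemma subfield_add: "x \<in> K \<Longrightarrow> y \<in> K \<Longrightarrow> x + y \<in> K"
  using subringE(7)[OF subfieldE(1)[OF subfield_K]] by simp

lemma subfield_mult: "x \<in> K \<Longrightarrow> y \<in> K \<Longrightarrow> x * y \<in> K"
  using subringE(6)[OF subfieldE(1)[OF subfield_K]] by simp

lemma subfield_uminus: "x \<in> K \<Longrightarrow> - x \<in> K"
  using subringE(5)[OF subfieldE(1)[OF subfield_K]] by simp

lemma subfield_diff: "x \<in> K \<Longrightarrow> y \<in> K \<Longrightarrow> x - y \<in> K"
  using subfield_add subfield_uminus by fastforce

lemma subfield_inverse: "x \<in> K \<Longrightarrow> inverse x \<in> K"
proof (cases "x = 0")
  case False
  interpret R: field "ambient :: 'a ring" by rule
  assume "x \<in> K"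
  then show ?thesis
    using R.subfield_m_inv(1)[OF subfield_K, of x] False by (simp add: ambient_m_inv)
qed (simp add: subfield_zero)

lemma subfield_divide: "x \<in> K \<Longrightarrow> y \<in> K \<Longrightarrow> x / y \<in> K"
  by (simp add: divide_inverse subfield_mult subfield_inverse)

lemma subfield_power: "x \<in> K \<Longrightarrow> x ^ n \<in> K"
  by (induction n) (auto simp: subfield_one subfield_mult)

lemma subfield_of_nat: "of_nat n \<in> K"
  by (induction n) (auto simp: subfield_zero subfield_one subfield_add)

lemma subfield_sum: "(\<And>i. i \<in> I \<Longrightarrow> g i \<in> K) \<Longrightarrow> sum g I \<in> K"
  by (induction I rule: infinite_finite_induct) (auto simp: subfield_zero subfield_add)

lemmas subfield_closed = subfield_zero subfield_one subfield_add subfield_mult subfield_uminus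
  subfield_diff subfield_inverse subfield_divide subfield_power subfield_of_nat subfield_sum

end

abbreviation lincomb :: "nat \<Rightarrow> (nat \<Rightarrow> 'a) \<Rightarrow> (nat \<Rightarrow> 'a) \<Rightarrow> 'a::abs_valued_field" where
  "lincomb m c u \<equiv> \<Sum>i<m. c i * u i"

definition lin_independent :: "'a::abs_valued_field set \<Rightarrow> nat \<Rightarrow> (nat \<Rightarrow> 'a) \<Rightarrow> bool" where
  "lin_independent Q m u \<longleftrightarrow>
     (\<forall>c \<in> {..<m} \<rightarrow> Q. lincomb m c u = 0 \<longrightarrow> (\<forall>i<m. c i = 0))"

lemma ambient_combine_eq_lincomb:
  assumes "length cs = length us"
  shows "ring.combine (ambient :: 'a::abs_valued_field ring) cs us
    = lincomb (length us) ((!) cs) ((!) us)"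
proof -
  interpret R: ring "ambient :: 'a ring" by rule
  show ?thesis
    using assms
    by (induction cs us rule: list_induct2)
      (simp_all add: sum.lessThan_Suc_shift del: sum.lessThan_Suc)
qed

lemma ambient_Span_map:
  assumes subfield_Q: "subfield Q (ambient :: 'a::abs_valued_field ring)"
  shows "ring.Span ambient Q (map u [0..<m]) = (\<lambda>c. lincomb m c u) ` ({..<m} \<rightarrow> Q)"
proof -
  interpret R: ring "ambient :: 'a ring" by rule
  have Span_iff: "x \<in> R.Span Q (map u [0..<m]) \<longleftrightarrow>
      (\<exists>cs. set cs \<subseteq> Q \<and> length cs = m \<and> x = lincomb m ((!) cs) u)" for x
    using R.Span_mem_iff_length_version[OF subfield_Q, of "map u [0..<m]" x]
    by (auto simp: ambient_combine_eq_lincomb)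
  show ?thesis
  proof (intro equalityI subsetI)
    fix x assume "x \<in> R.Span Q (map u [0..<m])"
    then obtain cs where cs_span: "set cs \<subseteq> Q" "length cs = m" "x = lincomb m ((!) cs) u"
      unfolding Span_iff by blast
    moreover have "(!) cs \<in> {..<m} \<rightarrow> Q"
      using cs_span(1,2) nth_mem by blast
    ultimately show "x \<in> (\<lambda>c. lincomb m c u) ` ({..<m} \<rightarrow> Q)" by blast
  next
    fix x assume "x \<in> (\<lambda>c. lincomb m c u) ` ({..<m} \<rightarrow> Q)"
    then obtain c where "c \<in> {..<m} \<rightarrow> Q" "x = lincomb m c u" by blast
    then show "x \<in> R.Span Q (map u [0..<m])"
      unfolding Span_iff by (intro exI[of _ "map c [0..<m]"]) auto
  qed
qed

lemma lin_independent_imp_ambient_independent: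
  assumes subfield_Q: "subfield Q (ambient :: 'a::abs_valued_field ring)"
    and indep: "lin_independent Q m u"
  shows "ring.independent ambient Q (map u [0..<m])"
proof (rule ccontr)
  interpret R: ring "ambient :: 'a ring" by rule
  assume dep: "\<not> ?thesis"
  obtain cs where cs_relation: "length cs = m" "R.combine cs (map u [0..<m]) = 0"
    "set cs \<subseteq> Q" "set cs \<noteq> {0}"
    by (rule R.dependent_imp_non_trivial_combine[OF subfield_Q _ dep]) simp_all
  have "lincomb m ((!) cs) u = 0"
    using cs_relation(1,2) by (simp add: ambient_combine_eq_lincomb)
  moreover have "(!) cs \<in> {..<m} \<rightarrow> Q"
    using cs_relation(1,3) nth_mem by blast
  ultimately have "set cs \<subseteq> {0}"
    using indep cs_relation(1) by (auto simp: lin_independent_def set_conv_nth)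
  with cs_relation(4) have "cs = []" by (auto simp: subset_singleton_iff)
  then show False
    using dep cs_relation(1) by simp
qed

context
  fixes Q K :: "'a::abs_valued_field set" and n m :: nat and u :: "nat \<Rightarrow> 'a"
  assumes subfield_Q: "subfield Q ambient" and dim: "ring.dimension ambient n Q K"
    and indep: "lin_independent Q m u" "u \<in> {..<m} \<rightarrow> K"
begin

lemma lin_independent_le_dimension: "m \<le> n"
proof -
  interpret R: ring "ambient :: 'a ring" by rule
  have "set (map u [0..<m]) \<subseteq> K" using indep(2) by auto
  from R.independent_length_le_dimension[OF subfield_Q dim
      lin_independent_imp_ambient_independent[OF subfield_Q indep(1)] this]
  show ?thesis by simp
qed

lemma lin_independent_spanning_eq_dimension:
  assumes "(\<lambda>c. lincomb m c u) ` ({..<m} \<rightarrow> Q) = K"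
  shows "m = n"
proof -
  interpret R: ring "ambient :: 'a ring" by rule
  have "set (map u [0..<m]) \<subseteq> K" using indep(2) by auto
  from R.independent_length_eq_dimension[OF subfield_Q dim
      lin_independent_imp_ambient_independent[OF subfield_Q indep(1)] this]
  show ?thesis
    using assms unfolding ambient_Span_map[OF subfield_Q] by simp
qed

end

section \<open>Residue discs of an ultrametric subfield\<close>

locale ultrametric_subfield =
  fixes K :: "'a::abs_valued_field set"
  assumes subfield_K: "subfield K ambient"
    and absv_add_le: "absv (x + y :: 'a) \<le> max (absv x) (absv y)"
begin

lemmas K_closed = subfield_closed[OF subfield_K]

lemma dist_le_max: "dist (x :: 'a) z \<le> max (dist x y) (dist y z)"
  using absv_add_le[of "x - y" "y - z"] by (simp add: dist_absv)

lemma dist_le_trans: "dist (x :: 'a) y \<le> t \<Longrightarrow> dist y z \<le> t \<Longrightarrow> dist x z \<le> t"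
  using dist_le_max[of x z y] by simp

lemma absv_eq_if_dist_less:
  assumes "dist x (y :: 'a) < absv y"
  shows "absv x = absv y"
  using dist_le_max[of x 0 y] dist_le_max[of y 0 x] assms
  by (simp add: absv_conv_dist dist_commute)

lemma absv_sum_le:
  assumes "t \<ge> 0" "\<And>i. i \<in> I \<Longrightarrow> absv (g i :: 'a) \<le> t"
  shows "absv (sum g I) \<le> t"
  using assms(2)
proof (induction I rule: infinite_finite_induct)
  case (insert i I)
  then show ?case using absv_add_le[of "g i" "sum g I"] by fastforce
qed (use assms(1) in auto)

lemma eventually_absv_eq_of_tendsto:
  assumes "(g \<longlongrightarrow> l) F" "l \<noteq> (0 :: 'a)"
  shows "\<forall>\<^sub>F x in F. absv (g x) = absv l"
  using tendstoD[OF assms(1), of "absv l"] assms(2)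
  by (auto elim!: eventually_mono intro: absv_eq_if_dist_less)

abbreviation integers ("\<O>") where "\<O> \<equiv> integer_ring K"

lemma integer_iff: "x \<in> \<O> \<longleftrightarrow> x \<in> K \<and> absv x \<le> 1"
  by (simp add: integer_ring_def)

lemma integer_zero: "0 \<in> \<O>"
  using K_closed by (simp add: integer_iff)

lemma integer_mult: "x \<in> \<O> \<Longrightarrow> y \<in> \<O> \<Longrightarrow> x * y \<in> \<O>"
  using K_closed by (simp add: integer_iff absv_mult mult_le_one)

lemma integer_add: "x \<in> \<O> \<Longrightarrow> y \<in> \<O> \<Longrightarrow> x + y \<in> \<O>"
  using K_closed absv_add_le[of x y] by (auto simp: integer_iff)

lemma integer_uminus: "x \<in> \<O> \<Longrightarrow> - x \<in> \<O>"
  using K_closed by (simp add: integer_iff)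

lemma integer_diff: "x \<in> \<O> \<Longrightarrow> y \<in> \<O> \<Longrightarrow> x - y \<in> \<O>"
  using integer_add[OF _ integer_uminus] by force

lemma integer_sum: "(\<And>i. i \<in> I \<Longrightarrow> g i \<in> \<O>) \<Longrightarrow> sum g I \<in> \<O>"
  by (induction I rule: infinite_finite_induct) (auto simp: integer_zero integer_add)

lemma integer_divide: "x \<in> K \<Longrightarrow> a \<in> K \<Longrightarrow> absv x \<le> absv a \<Longrightarrow> x / a \<in> \<O>"
  using K_closed by (simp add: integer_iff absv_divide divide_le_eq_1)

definition disc :: "'a \<Rightarrow> real \<Rightarrow> 'a set" where
  "disc a t = {x \<in> K. dist x a \<le> t}"

lemma disc_eq_iff:
  assumes "x \<in> K" "0 \<le> t"
  shows "disc x t = disc y t \<longleftrightarrow> dist x y \<le> t"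
proof
  assume "disc x t = disc y t"
  moreover have "x \<in> disc x t" using assms by (simp add: disc_def)
  ultimately show "dist x y \<le> t" by (simp add: disc_def)
next
  assume "dist x y \<le> t"
  then have "dist z x \<le> t \<longleftrightarrow> dist z y \<le> t" for z
    using dist_le_trans[of z x t y] dist_le_trans[of z y t x] by (auto simp: dist_commute)
  then show "disc x t = disc y t" by (simp add: disc_def)
qed

lemma disc_Int_disc_eq_empty:
  assumes "t < dist x y"
  shows "disc x t \<inter> disc y t = {}"
proof (rule ccontr)
  assume "\<not> ?thesis"
  then obtain z where "dist z x \<le> t" "dist z y \<le> t" by (auto simp: disc_def)
  then show False using dist_le_max[of x y z] assms by (simp add: dist_commute)
qed

definition residue_discs :: "real \<Rightarrow> 'a set set" where
  "residue_discs t = (\<lambda>x. disc x t) ` \<O>"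

text \<open>As the cardinality of an infinite set is \<open>0\<close>, \<open>residue_index t > 0\<close> says that there are only
  finitely many residue discs.\<close>

definition residue_index :: "real \<Rightarrow> nat" where
  "residue_index t = card (residue_discs t)"

lemma residue_index_eq_card:
  assumes "0 \<le> t" and g_in: "\<And>i. i \<in> I \<Longrightarrow> g i \<in> \<O>"
    and covers: "\<And>x. x \<in> \<O> \<Longrightarrow> \<exists>i\<in>I. dist x (g i) \<le> t"
    and separated: "\<And>i j. i \<in> I \<Longrightarrow> j \<in> I \<Longrightarrow> dist (g i) (g j) \<le> t \<Longrightarrow> i = j"
  shows "residue_index t = card I"
proof -
  have eq_iff: "disc x t = disc y t \<longleftrightarrow> dist x y \<le> t" if "x \<in> \<O>" for x y
    using that assms(1) by (intro disc_eq_iff) (auto simp: integer_iff)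
  have "inj_on (\<lambda>i. disc (g i) t) I"
    using separated g_in eq_iff by (auto intro!: inj_onI)
  moreover have "(\<lambda>i. disc (g i) t) ` I = residue_discs t"
    unfolding residue_discs_def using g_in covers eq_iff by (fastforce simp: image_iff)
  ultimately show ?thesis
    unfolding residue_index_def by (metis card_image)
qed

lemma residue_representativesE:
  assumes "0 \<le> t"
  obtains R where "R \<subseteq> \<O>" "card R = residue_index t"
    "\<And>x. x \<in> \<O> \<Longrightarrow> \<exists>y\<in>R. dist x y \<le> t"
    "\<And>x y. x \<in> R \<Longrightarrow> y \<in> R \<Longrightarrow> dist x y \<le> t \<Longrightarrow> x = y"
proof -
  have eq_iff: "disc x t = disc y t \<longleftrightarrow> dist x y \<le> t" if "x \<in> \<O>" for x y
    using that assms by (intro disc_eq_iff) (auto simp: integer_iff)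
  obtain R where "R \<subseteq> \<O>" and inj: "inj_on (\<lambda>x. disc x t) R"
    and discs_eq: "residue_discs t = (\<lambda>x. disc x t) ` R"
    using subset_image_inj[of "residue_discs t" "\<lambda>x. disc x t" \<O>]
    by (auto simp: residue_discs_def)
  show thesis
  proof (rule that[OF \<open>R \<subseteq> \<O>\<close>])
    show "card R = residue_index t"
      using card_image[OF inj] by (simp only: residue_index_def discs_eq)
    show "\<exists>y\<in>R. dist x y \<le> t" if x_integer: "x \<in> \<O>" for x
    proof -
      have "disc x t \<in> (\<lambda>x. disc x t) ` R"
        unfolding discs_eq[symmetric] residue_discs_def using x_integer by (rule imageI)
      then show ?thesis using eq_iff[OF x_integer] by blast
    qed
    show "x = y" if "x \<in> R" "y \<in> R" "dist x y \<le> t" for x y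
      using inj_onD[OF inj _ that(1,2)] that \<open>R \<subseteq> \<O>\<close> eq_iff by blast
  qed
qed

lemma residue_index_1: "residue_index 1 = 1"
  using residue_index_eq_card[of 1 "{0}" "\<lambda>x. x"] K_closed(1)
  by (simp add: integer_iff absv_conv_dist)

lemma dist_add_mult:
  assumes "a \<noteq> 0"
  shows "dist x (r + a * s :: 'a) = absv a * dist ((x - r) / a) s"
proof -
  have "x - (r + a * s) = a * ((x - r) / a - s)" using assms by (simp add: field_simps)
  then show ?thesis by (simp add: dist_absv absv_mult)
qed

lemma dist_add_mult_self_le: "s \<in> \<O> \<Longrightarrow> dist (r + a * s) r \<le> absv a"
  by (simp add: dist_absv absv_mult integer_iff mult_left_le)

lemma residue_index_mult:
  assumes a_integer: "a \<in> \<O>" "a \<noteq> 0" and t_bounds: "0 \<le> t" "t \<le> 1"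
  shows "residue_index (absv a * t) = residue_index (absv a) * residue_index t"
proof -
  obtain R where "R \<subseteq> \<O>" and card_R: "card R = residue_index (absv a)"
    and R_covers: "\<And>x. x \<in> \<O> \<Longrightarrow> \<exists>r\<in>R. dist x r \<le> absv a"
    and R_separated: "\<And>r r'. r \<in> R \<Longrightarrow> r' \<in> R \<Longrightarrow> dist r r' \<le> absv a \<Longrightarrow> r = r'"
    by (rule residue_representativesE[of "absv a"]) auto
  obtain S where "S \<subseteq> \<O>" and card_S: "card S = residue_index t"
    and S_covers: "\<And>x. x \<in> \<O> \<Longrightarrow> \<exists>s\<in>S. dist x s \<le> t"
    and S_separated: "\<And>s s'. s \<in> S \<Longrightarrow> s' \<in> S \<Longrightarrow> dist s s' \<le> t \<Longrightarrow> s = s'"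
    by (rule residue_representativesE[of t]) (use t_bounds in auto)
  have "residue_index (absv a * t) = card (R \<times> S)"
  proof (rule residue_index_eq_card[where g = "\<lambda>(r, s). r + a * s"]; clarify?)
    show "r + a * s \<in> \<O>" if "r \<in> R" "s \<in> S" for r s
      using that \<open>R \<subseteq> \<O>\<close> \<open>S \<subseteq> \<O>\<close> a_integer by (auto intro!: integer_add integer_mult)
    show "\<exists>i\<in>R \<times> S. dist x (case i of (r, s) \<Rightarrow> r + a * s) \<le> absv a * t" if x_integer: "x \<in> \<O>" for x
    proof -
      obtain r where r_near: "r \<in> R" "dist x r \<le> absv a" using R_covers x_integer by blast
      then have "(x - r) / a \<in> \<O>"
        using x_integer a_integer \<open>R \<subseteq> \<O>\<close> K_closed(6)
        by (intro integer_divide) (auto simp: dist_absv integer_iff)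
      then obtain s where "s \<in> S" "dist ((x - r) / a) s \<le> t" using S_covers by blast
      then show ?thesis
        using r_near(1) dist_add_mult[OF a_integer(2)]
        by (intro bexI[of _ "(r, s)"]) (auto simp: mult_left_mono)
    qed
    show "r = r' \<and> s = s'"
      if representatives: "r \<in> R" "s \<in> S" "r' \<in> R" "s' \<in> S"
        and close: "dist (r + a * s) (r' + a * s') \<le> absv a * t" for r s r' s'
    proof -
      have "dist (r + a * s) (r' + a * s') \<le> absv a"
        using close t_bounds mult_left_le[of t "absv a"] by simp
      moreover have "s \<in> \<O>" "s' \<in> \<O>"
        using representatives \<open>S \<subseteq> \<O>\<close> by auto
      ultimately have "r = r'"
        using representatives dist_add_mult_self_le R_separated
        by (metis dist_commute dist_le_trans)
      then show ?thesis
        using close representatives S_separated a_integer(2)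
        by (simp add: dist_add_mult[OF a_integer(2)])
    qed
  qed (use t_bounds in simp)
  then show ?thesis by (simp add: card_cartesian_product card_R card_S)
qed

definition uniformizer :: "'a \<Rightarrow> bool" where
  "uniformizer \<pi> \<longleftrightarrow>
     \<pi> \<in> K \<and> \<pi> \<noteq> 0 \<and> absv \<pi> < 1 \<and> (\<forall>x\<in>K. absv x < 1 \<longrightarrow> absv x \<le> absv \<pi>)"

lemma finite_absv_image_if_residue_index_pos:
  assumes "residue_index t > 0" "0 \<le> t"
  shows "finite (absv ` {x \<in> \<O>. t < absv x})"
proof -
  obtain R where card_R: "card R = residue_index t"
    and R_covers: "\<And>x. x \<in> \<O> \<Longrightarrow> \<exists>y\<in>R. dist x y \<le> t"
    by (rule residue_representativesE[OF assms(2)]) auto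
  have "absv x \<in> absv ` R" if "x \<in> \<O>" "t < absv x" for x
  proof -
    obtain y where y_near: "y \<in> R" "dist x y \<le> t" using R_covers \<open>x \<in> \<O>\<close> by blast
    then have "absv y = absv x"
      using that(2) by (intro absv_eq_if_dist_less) (simp add: dist_commute)
    then show ?thesis using y_near(1) by (metis imageI)
  qed
  then have "absv ` {x \<in> \<O>. t < absv x} \<subseteq> absv ` R" by blast
  moreover have "finite R" using card_R assms(1) by (simp add: card_ge_0_finite)
  ultimately show ?thesis by (meson finite_imageI finite_subset)
qed

lemma uniformizer_exists:
  assumes x_nonunit: "x \<in> K" "x \<noteq> 0" "absv x < 1" "residue_index (absv x) > 0"
  shows "\<exists>\<pi>. uniformizer \<pi>"
proof -
  define V where "V = absv ` {y \<in> K. absv x \<le> absv y \<and> absv y < 1}"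
  have "V \<subseteq> insert (absv x) (absv ` {y \<in> \<O>. absv x < absv y})"
    by (auto simp: V_def integer_iff)
  then have "finite V"
    using finite_absv_image_if_residue_index_pos[OF x_nonunit(4)]
    by (meson absv_nonneg finite.insertI finite_subset)
  have "absv x \<in> V" using x_nonunit by (auto simp: V_def)
  then have "Max V \<in> V" using \<open>finite V\<close> by (intro Max_in) auto
  then obtain \<pi> where Max_V: "Max V = absv \<pi>"
    and \<pi>_bounds: "\<pi> \<in> K" "absv x \<le> absv \<pi>" "absv \<pi> < 1"
    by (auto simp: V_def)
  have "absv y \<le> absv \<pi>" if y_nonunit: "y \<in> K" "absv y < 1" for y
  proof (cases "absv x \<le> absv y")
    case True
    then have "absv y \<in> V" using y_nonunit by (auto simp: V_def)
    then show ?thesis using Max_ge[OF \<open>finite V\<close>] Max_V by metis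
  qed (use \<pi>_bounds(2) in simp)
  then have "uniformizer \<pi>"
    using \<pi>_bounds x_nonunit(2)
    by (auto simp: uniformizer_def simp flip: absv_pos_iff intro: less_le_trans)
  then show ?thesis ..
qed

end

locale discretely_valued_subfield = ultrametric_subfield +
  fixes \<pi>
  assumes uniformizer: "uniformizer \<pi>"
begin

lemma uniformizerD:
  "\<pi> \<in> K" "\<pi> \<noteq> 0" "absv \<pi> < 1" "x \<in> K \<Longrightarrow> absv x < 1 \<Longrightarrow> absv x \<le> absv \<pi>"
  using uniformizer by (auto simp: uniformizer_def)

lemma absv_eq_uniformizer_power:
  assumes x_integer: "x \<in> \<O>" "x \<noteq> 0"
  shows "\<exists>k. absv x = absv \<pi> ^ k"
proof -
  obtain N where "absv \<pi> ^ N < absv x"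
    using real_arch_pow_inv[of "absv x" "absv \<pi>"] x_integer uniformizerD by auto
  moreover have "\<not> absv \<pi> ^ 0 < absv x" using x_integer by (simp add: integer_iff)
  ultimately obtain k where "\<forall>i\<le>k. \<not> absv \<pi> ^ i < absv x"
    and power_less: "absv \<pi> ^ Suc k < absv x"
    using ex_least_nat_less[of "\<lambda>k. absv \<pi> ^ k < absv x"] by metis
  then have le_power: "absv x \<le> absv \<pi> ^ k" by (simp add: not_less)
  define y where "y = x / \<pi> ^ k"
  have "y \<in> K" and absv_y: "absv y = absv x / absv \<pi> ^ k"
    using x_integer uniformizerD(1) K_closed
    by (auto simp: y_def integer_iff absv_divide absv_power)
  have "absv \<pi> < absv y"
    using power_less uniformizerD(2) by (simp add: absv_y field_simps)
  then have "\<not> absv y < 1" using uniformizerD(4)[OF \<open>y \<in> K\<close>] by linarith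
  then show ?thesis
    using le_power uniformizerD(2) by (intro exI[of _ k]) (simp add: absv_y)
qed

lemma residue_index_uniformizer_power: "residue_index (absv \<pi> ^ k) = residue_index (absv \<pi>) ^ k"
proof (induction k)
  case (Suc k)
  then show ?case
    using residue_index_mult[of \<pi> "absv \<pi> ^ k"] uniformizerD
    by (simp add: integer_iff power_le_one)
qed (simp add: residue_index_1)

lemma carrier_residue_field: "carrier (residue_field K) = residue_discs (absv \<pi>)"
proof -
  have coset_eq_disc: "(\<Union>h\<in>maximal_ideal K. {h + a}) = disc a (absv \<pi>)" if a_in_K: "a \<in> K" for a
  proof (intro equalityI subsetI)
    fix y assume "y \<in> (\<Union>h\<in>maximal_ideal K. {h + a})"
    then show "y \<in> disc a (absv \<pi>)"
      using a_in_K K_closed uniformizerD(4) by (auto simp: disc_def maximal_ideal_def dist_absv)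
  next
    fix y assume "y \<in> disc a (absv \<pi>)"
    then have "y - a \<in> maximal_ideal K"
      using a_in_K K_closed uniformizerD(3) by (auto simp: disc_def maximal_ideal_def dist_absv)
    then show "y \<in> (\<Union>h\<in>maximal_ideal K. {h + a})"
      by (rule UN_I) simp
  qed
  have "carrier (residue_field K) = (\<lambda>a. \<Union>h\<in>maximal_ideal K. {h + a}) ` \<O>"
    by (auto simp: residue_field_def FactRing_def A_RCOSETS_defs r_coset_def)
  also have "\<dots> = residue_discs (absv \<pi>)"
    unfolding residue_discs_def using coset_eq_disc by (intro image_cong) (auto simp: integer_iff)
  finally show ?thesis .
qed

text \<open>Both sides of the identity are powers of their values at \<open>\<pi>\<close>, so it is enough to know it at
  one nonunit.\<close>

lemma residue_index_times_absv_power_eq_1: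
  assumes y_nonunit: "y \<in> \<O>" "y \<noteq> 0" "absv y < 1" "real (residue_index (absv y)) * absv y ^ r = 1"
    and x_integer: "x \<in> \<O>" "x \<noteq> 0"
  shows "real (residue_index (absv x)) * absv x ^ r = 1"
proof -
  define D where "D = real (residue_index (absv \<pi>)) * absv \<pi> ^ r"
  have power_D: "real (residue_index (absv z)) * absv z ^ r = D ^ k" if "absv z = absv \<pi> ^ k"
    for z :: 'a and k
    by (simp add: that residue_index_uniformizer_power D_def power_mult_distrib
        mult.commute[of k r] flip: power_mult)
  obtain e where absv_y_eq: "absv y = absv \<pi> ^ e"
    using absv_eq_uniformizer_power[OF y_nonunit(1,2)] by blast
  then have "e > 0" "D ^ e = 1"
    using y_nonunit(3,4) power_D[OF absv_y_eq] by (auto intro: gr0I)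
  moreover have "D \<ge> 0" by (simp add: D_def)
  ultimately have "D = 1"
    using power_eq_imp_eq_base[of D e 1] by simp
  then show ?thesis
    using absv_eq_uniformizer_power[OF x_integer] power_D by fastforce
qed

end

section \<open>Haar measure of discs\<close>

context ultrametric_subfield
begin

lemma disc_in_sets:
  assumes "haar_measure_on K \<mu>"
  shows "disc a t \<in> sets \<mu>"
proof -
  have "disc a t = K \<inter> cball a t"
    by (auto simp: disc_def dist_commute)
  then show ?thesis
    using assms by (auto simp: haar_measure_on_def sets_restrict_space)
qed

lemma emeasure_disc_translate:
  assumes haar: "haar_measure_on K \<mu>" and a_in_K: "a \<in> K"
  shows "emeasure \<mu> (disc a t) = emeasure \<mu> (disc 0 t)"
proof -
  have "(+) a ` disc 0 t = disc a t"
  proof (intro equalityI subsetI)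
    fix y assume "y \<in> disc a t"
    then have "y - a \<in> disc 0 t" using a_in_K K_closed by (simp add: disc_def dist_absv)
    then show "y \<in> (+) a ` disc 0 t" by (rule rev_image_eqI) simp
  qed (use a_in_K K_closed in \<open>auto simp: disc_def dist_absv\<close>)
  then show ?thesis
    using haar a_in_K disc_in_sets[OF haar, of 0 t] unfolding haar_measure_on_def by metis
qed

lemma residue_index_times_emeasure_disc:
  assumes haar: "haar_measure_on K \<mu>" and t_bounds: "0 \<le> t" "t \<le> 1"
    and pos: "residue_index t > 0" and a_in_K: "a \<in> K"
  shows "of_nat (residue_index t) * emeasure \<mu> (disc a t) = emeasure \<mu> \<O>"
proof -
  obtain R where "R \<subseteq> \<O>" and card_R: "card R = residue_index t"
    and R_covers: "\<And>x. x \<in> \<O> \<Longrightarrow> \<exists>y\<in>R. dist x y \<le> t"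
    and R_separated: "\<And>x y. x \<in> R \<Longrightarrow> y \<in> R \<Longrightarrow> dist x y \<le> t \<Longrightarrow> x = y"
    using residue_representativesE[OF t_bounds(1)] by metis
  have "\<O> = (\<Union>y\<in>R. disc y t)"
  proof (intro equalityI subsetI)
    fix x assume "x \<in> \<O>"
    then show "x \<in> (\<Union>y\<in>R. disc y t)"
      using R_covers by (auto simp: disc_def integer_iff)
  next
    fix x assume "x \<in> (\<Union>y\<in>R. disc y t)"
    then obtain y where y_near: "y \<in> R" "x \<in> K" "dist x y \<le> t" by (auto simp: disc_def)
    then have "dist x y \<le> 1" "dist y 0 \<le> 1"
      using \<open>R \<subseteq> \<O>\<close> t_bounds(2) by (auto simp: integer_iff absv_conv_dist)
    then show "x \<in> \<O>"
      using y_near(2) dist_le_trans by (auto simp: integer_iff absv_conv_dist)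
  qed
  moreover have "disjoint_family_on (\<lambda>y. disc y t) R"
    unfolding disjoint_family_on_def
    using R_separated disc_Int_disc_eq_empty by (meson not_le)
  moreover have "finite R" using card_R pos by (simp add: card_ge_0_finite)
  ultimately have "emeasure \<mu> \<O> = (\<Sum>y\<in>R. emeasure \<mu> (disc y t))"
    using disc_in_sets[OF haar] by (simp add: sum_emeasure image_subset_iff)
  also have "\<dots> = (\<Sum>y\<in>R. emeasure \<mu> (disc a t))"
    using \<open>R \<subseteq> \<O>\<close> a_in_K
    by (intro sum.cong) (auto simp: emeasure_disc_translate[OF haar] integer_iff)
  also have "\<dots> = of_nat (residue_index t) * emeasure \<mu> (disc a t)"
    by (simp flip: card_R)
  finally show ?thesis ..
qed

lemma measure_disc:
  assumes haar: "haar_measure_on K \<mu>" "emeasure \<mu> \<O> = 1"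
    and b_index: "b \<in> \<O>" "real (residue_index (absv b)) * absv b ^ r = 1" and a_in_K: "a \<in> K"
  shows "measure \<mu> (disc a (absv b)) = absv b ^ r"
proof -
  have pos: "residue_index (absv b) > 0" using b_index(2) by (intro gr0I) simp
  have "of_nat (residue_index (absv b)) * emeasure \<mu> (disc a (absv b)) = 1"
    using residue_index_times_emeasure_disc[OF haar(1) _ _ pos a_in_K] b_index(1) haar(2)
    by (simp add: integer_iff)
  from arg_cong[OF this, of enn2real]
  have "real (residue_index (absv b)) * measure \<mu> (disc a (absv b)) = 1"
    by (simp add: enn2real_mult measure_def)
  with b_index(2) show ?thesis
    using pos by (metis mult_left_cancel of_nat_0_less_iff less_irrefl)
qed

end

section \<open>The \<open>p\<close>-adic absolute value\<close>

locale padic_field =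
  fixes p :: nat and Qp :: "'a::abs_valued_field set"
  assumes prime_p: "Factorial_Ring.prime p"
    and padic_numbers: "padic_numbers p Qp"
begin

lemma prime_int_p: "Factorial_Ring.prime (int p)"
  using prime_p by simp

lemma p_gt_1: "p > 1"
  using prime_p by (rule prime_gt_1_nat)

abbreviation p_in_field :: 'a ("\<p>") where
  "\<p> \<equiv> of_nat p"

lemma absv_of_int_eq_powrE:
  obtains c where "c > 0"
    "\<And>n. n \<noteq> 0 \<Longrightarrow> absv (of_int n :: 'a) = real p powr (- c * real (multiplicity (int p) n))"
proof -
  obtain c where "c > 0" and absv_of_rat: "\<And>x. absv (of_rat x :: 'a) = padic_abs p x powr c"
    using padic_numbers by (auto simp: padic_numbers_def)
  have "padic_abs p (of_int n) = real p powr - real (multiplicity (int p) n)" if "n \<noteq> 0" for n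
    using that p_gt_1 by (simp add: padic_abs_def powr_minus powr_realpow power_int_minus)
  then have "absv (of_int n :: 'a) = real p powr (- c * real (multiplicity (int p) n))"
    if "n \<noteq> 0" for n
    using absv_of_rat[of "of_int n"] that by (simp add: powr_powr mult.commute)
  with \<open>c > 0\<close> show thesis by (rule that)
qed

lemma absv_of_int_le_1: "absv (of_int n :: 'a) \<le> 1"
proof (cases "n = 0")
  case False
  obtain c where "c > 0" "absv (of_int n :: 'a) = real p powr (- c * real (multiplicity (int p) n))"
    using absv_of_int_eq_powrE False by metis
  moreover from this have "real p powr (- c * real (multiplicity (int p) n)) \<le> real p powr 0"
    using p_gt_1 by (intro powr_mono) auto
  ultimately show ?thesis using p_gt_1 by simp
qed simp

lemma absv_of_nat_le_1: "absv (of_nat n :: 'a) \<le> 1"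
  using absv_of_int_le_1[of "int n"] by simp

lemma absv_of_int_eq_1_if_not_dvd:
  assumes "\<not> int p dvd n"
  shows "absv (of_int n :: 'a) = 1"
proof -
  have "n \<noteq> 0" using assms by auto
  then obtain c where "absv (of_int n :: 'a) = real p powr (- c * real (multiplicity (int p) n))"
    using absv_of_int_eq_powrE by metis
  then show ?thesis
    using assms p_gt_1 by (simp add: not_dvd_imp_multiplicity_0)
qed

lemma absv_p_pos: "absv \<p> > 0"
  using p_gt_1 by simp

lemma absv_p_less_1: "absv \<p> < 1"
proof -
  obtain c where "c > 0"
    and absv_eq: "absv (of_int (int p) :: 'a)
      = real p powr (- c * real (multiplicity (int p) (int p)))"
    using absv_of_int_eq_powrE p_gt_1 by (metis of_nat_0_eq_iff not_one_less_zero)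
  have "multiplicity (int p) (int p) = 1"
    using prime_int_p by (intro multiplicity_self) auto
  then have "absv \<p> = real p powr - c" using absv_eq by simp
  also have "\<dots> < real p powr 0" using \<open>c > 0\<close> p_gt_1 by (intro powr_less_mono) auto
  finally show ?thesis using p_gt_1 by simp
qed

lemma absv_of_int_le_absv_p_if_dvd:
  assumes "int p dvd n"
  shows "absv (of_int n :: 'a) \<le> absv \<p>"
  using assms absv_of_int_le_1 by (auto simp: absv_mult mult_left_le elim!: dvdE)

sublocale Qp: ultrametric_subfield Qp
proof (rule ultrametric_subfield.intro)
  show "subfield Qp ambient"
    using padic_numbers unfolding padic_numbers_def by blast
  show "absv (x + y) \<le> max (absv x) (absv y)" for x y :: 'a
    by (intro absv_add_le_max_if_of_nat_le_1 absv_of_nat_le_1)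
qed

abbreviation Zp where "Zp \<equiv> integer_ring Qp"

lemma of_nat_in_Zp: "of_nat k \<in> Zp"
  using absv_of_nat_le_1 Qp.K_closed by (simp add: Qp.integer_iff)

lemma quotient_of_denominator_not_dvd:
  assumes integral: "absv (of_rat x :: 'a) \<le> 1" and quotient: "quotient_of x = (m, n)"
  shows "\<not> int p dvd n"
proof
  assume dvd: "int p dvd n"
  have "n > 0" "coprime m n" and x_eq: "x = of_int m / of_int n"
    using quotient quotient_of_denom_pos quotient_of_coprime quotient_of_div by auto
  then have "\<not> int p dvd m"
    using dvd prime_int_p by (meson coprime_common_divisor not_prime_unit)
  then have "absv (of_rat x :: 'a) = 1 / absv (of_int n :: 'a)"
    by (simp add: x_eq of_rat_divide absv_divide absv_of_int_eq_1_if_not_dvd)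
  moreover have "absv (of_int n :: 'a) < 1"
    using absv_of_int_le_absv_p_if_dvd[OF dvd] absv_p_less_1 by simp
  ultimately show False
    using integral \<open>n > 0\<close> by (simp add: divide_le_eq)
qed

lemma of_rat_near_natE:
  assumes "absv (of_rat x :: 'a) \<le> 1"
  obtains k where "k < p" "dist (of_rat x :: 'a) (of_nat k) \<le> absv \<p>"
proof -
  obtain m n where quotient: "quotient_of x = (m, n)" by (cases "quotient_of x")
  have "n > 0" and x_eq: "x = of_int m / of_int n"
    using quotient quotient_of_denom_pos quotient_of_div by auto
  have denominator_not_dvd: "\<not> int p dvd n"
    using quotient_of_denominator_not_dvd[OF assms quotient] .
  then have "coprime n (int p)"
    using prime_int_p by (metis coprime_commute prime_imp_coprime)
  then obtain w where inverse_mod_p: "[n * w = 1] (mod int p)"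
    using cong_solve_coprime_int by blast
  define k where "k = nat ((w * m) mod int p)"
  have "k < p" and int_k: "int k = (w * m) mod int p"
    using p_gt_1 by (auto simp: k_def nat_less_iff)
  have "[n * int k = n * (w * m)] (mod int p)"
    unfolding int_k by (simp add: cong_def mod_mult_right_eq)
  also have "[n * (w * m) = m] (mod int p)"
    using cong_scalar_right[OF inverse_mod_p, of m] by (simp add: mult.assoc)
  finally have numerator_dvd: "int p dvd m - n * int k"
    by (metis cong_iff_dvd_diff cong_sym)
  have "of_rat x - of_nat k = (of_int (m - n * int k) / of_int n :: 'a)"
    using \<open>n > 0\<close> by (simp add: x_eq of_rat_divide field_simps)
  then have "dist (of_rat x :: 'a) (of_nat k) \<le> absv \<p>"
    using absv_of_int_eq_1_if_not_dvd[OF denominator_not_dvd]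
      absv_of_int_le_absv_p_if_dvd[OF numerator_dvd]
    by (simp add: dist_absv absv_divide)
  with \<open>k < p\<close> show thesis by (rule that)
qed

lemma Zp_near_natE:
  assumes "a \<in> Zp"
  obtains k where "k < p" "dist a (of_nat k) \<le> absv \<p>"
proof -
  have a_integral: "a \<in> closure \<rat>" "absv a \<le> 1"
    using assms padic_numbers by (auto simp: padic_numbers_def Qp.integer_iff)
  then obtain y :: 'a where "y \<in> \<rat>" "dist y a < absv \<p>"
    using absv_p_pos by (meson closure_approachable)
  then obtain x where rat_near: "dist (of_rat x) a < absv \<p>"
    by (auto elim!: Rats_cases)
  then have "dist (of_rat x) a \<le> 1" "dist a 0 \<le> 1"
    using a_integral(2) absv_p_less_1 by (auto simp flip: absv_conv_dist)
  from Qp.dist_le_trans[OF this] have "absv (of_rat x :: 'a) \<le> 1"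
    by (simp add: absv_conv_dist)
  then obtain k where k_near: "k < p" "dist (of_rat x :: 'a) (of_nat k) \<le> absv \<p>"
    by (rule of_rat_near_natE)
  have "dist a (of_nat k) \<le> absv \<p>"
    using Qp.dist_le_trans[OF _ k_near(2)] rat_near by (simp add: dist_commute)
  with k_near(1) show thesis by (rule that)
qed

lemma dist_of_nat_le_absv_p_imp_eq:
  assumes "k < p" "l < p" "dist (of_nat k) (of_nat l :: 'a) \<le> absv \<p>"
  shows "k = l"
proof (rule ccontr)
  assume "k \<noteq> l"
  then have "\<not> int p dvd int k - int l"
    using assms zdvd_not_zless[of "\<bar>int k - int l\<bar>" "int p"] by auto
  from absv_of_int_eq_1_if_not_dvd[OF this] show False
    using assms(3) absv_p_less_1 by (simp add: dist_absv)
qed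

lemma Zp_absv_eq_1_if_gt_absv_p:
  assumes "a \<in> Zp" "absv \<p> < absv a"
  shows "absv a = 1"
proof -
  obtain k where k_near: "k < p" "dist a (of_nat k) \<le> absv \<p>"
    using Zp_near_natE[OF assms(1)] .
  then have "k \<noteq> 0" using assms(2) by (intro notI) (simp add: absv_conv_dist)
  then have "\<not> int p dvd int k"
    using k_near(1) by (auto dest: dvd_imp_le)
  from absv_of_int_eq_1_if_not_dvd[OF this] show ?thesis
    using Qp.absv_eq_if_dist_less[of a "of_nat k"] k_near(2) absv_p_less_1 by simp
qed

end

section \<open>Finite extensions of the \<open>p\<close>-adic numbers\<close>

locale padic_extension = padic_field p Qp + ultrametric_subfield K
  for p and Qp K :: "'a::abs_valued_field set" +
  fixes n :: nat
  assumes Qp_subset: "Qp \<subseteq> K"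
    and dimension_K: "ring.dimension ambient n Qp K"
begin

definition independent_mod_p :: "nat \<Rightarrow> (nat \<Rightarrow> 'a) \<Rightarrow> bool" where
  "independent_mod_p m u \<longleftrightarrow> u \<in> {..<m} \<rightarrow> \<O> \<and>
     (\<forall>c \<in> {..<m} \<rightarrow> Zp. absv (lincomb m c u) \<le> absv \<p> \<longrightarrow>
        (\<forall>i<m. absv (c i) \<le> absv \<p>))"

lemma independent_mod_pD:
  assumes "independent_mod_p m u" "c \<in> {..<m} \<rightarrow> Zp"
    "absv (lincomb m c u) \<le> absv \<p>" "i < m"
  shows "absv (c i) \<le> absv \<p>"
  using assms unfolding independent_mod_p_def by blast

lemma Zp_subset_integers: "Zp \<subseteq> \<O>"
  using Qp_subset by (auto simp: integer_iff Qp.integer_iff)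

lemma dist_lincomb_le:
  assumes "0 \<le> t" and u_integral: "u \<in> {..<m} \<rightarrow> \<O>"
    and coeff_dist: "\<And>i. i < m \<Longrightarrow> dist (c i) (d i) \<le> t"
  shows "dist (lincomb m c u) (lincomb m d u) \<le> t"
proof -
  have "dist (lincomb m c u) (lincomb m d u) = absv (\<Sum>i<m. (c i - d i) * u i)"
    by (simp add: dist_absv sum_subtractf left_diff_distrib)
  also have "\<dots> \<le> t"
  proof (rule absv_sum_le[OF \<open>0 \<le> t\<close>])
    fix i assume i_less: "i \<in> {..<m}"
    then have "u i \<in> \<O>" using u_integral by auto
    then show "absv ((c i - d i) * u i) \<le> t"
      using coeff_dist[of i] i_less \<open>0 \<le> t\<close> mult_mono[of "dist (c i) (d i)" t "absv (u i)" 1]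
      by (simp add: absv_mult dist_absv integer_iff)
  qed
  finally show ?thesis .
qed

lemma lincomb_in_integers:
  assumes "u \<in> {..<m} \<rightarrow> \<O>" "c \<in> {..<m} \<rightarrow> Zp"
  shows "lincomb m c u \<in> \<O>"
proof (rule integer_sum)
  fix i assume "i \<in> {..<m}"
  then have "c i \<in> \<O>" "u i \<in> \<O>"
    using assms Zp_subset_integers by auto
  then show "c i * u i \<in> \<O>" by (rule integer_mult)
qed

text \<open>Dividing by a coefficient of maximal absolute value makes the coefficients integral.\<close>

lemma independent_mod_p_absv_coeff_le:
  assumes indep: "independent_mod_p m u" and coeffs: "c \<in> {..<m} \<rightarrow> Qp" and i_less: "i < m"
  shows "absv \<p> * absv (c i) \<le> absv (lincomb m c u)"
proof (rule ccontr)
  assume lincomb_less: "\<not> ?thesis"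
  define M where "M = (MAX k\<in>{..<m}. absv (c k))"
  have le_M: "absv (c k) \<le> M" if "k < m" for k
    unfolding M_def using that by (intro Max_ge) auto
  have "M \<in> (\<lambda>k. absv (c k)) ` {..<m}"
    unfolding M_def using i_less by (intro Max_in) auto
  then obtain j where max_at_j: "j < m" "M = absv (c j)" by auto
  have "absv \<p> * absv (c i) \<le> absv \<p> * absv (c j)"
    using le_M[OF i_less] max_at_j(2) by (intro mult_left_mono) auto
  with lincomb_less have lincomb_less_max: "absv (lincomb m c u) < absv \<p> * absv (c j)"
    by linarith
  then have "c j \<noteq> 0" by (metis absv_0 absv_nonneg mult_zero_right not_le)
  have "(\<lambda>k. c k / c j) \<in> {..<m} \<rightarrow> Zp"
    using coeffs max_at_j le_M by (auto intro!: Qp.integer_divide)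
  moreover have lincomb_divide: "lincomb m (\<lambda>k. c k / c j) u = lincomb m c u / c j"
    by (simp add: sum_divide_distrib)
  have "absv (lincomb m (\<lambda>k. c k / c j) u) \<le> absv \<p>"
    unfolding lincomb_divide absv_divide using lincomb_less_max \<open>c j \<noteq> 0\<close>
    by (simp add: field_simps)
  ultimately have "absv (c j / c j) \<le> absv \<p>"
    using independent_mod_pD[OF indep] max_at_j(1) by blast
  then show False
    using \<open>c j \<noteq> 0\<close> absv_p_less_1 by simp
qed

lemma independent_mod_p_imp_lin_independent:
  assumes "independent_mod_p m u"
  shows "lin_independent Qp m u"
  unfolding lin_independent_def
proof (intro ballI impI allI)
  fix c i assume "c \<in> {..<m} \<rightarrow> Qp" "lincomb m c u = 0" "i < m"
  then have "absv \<p> * absv (c i) \<le> 0"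
    using independent_mod_p_absv_coeff_le[OF assms] by (metis absv_0)
  then show "c i = 0"
    using absv_p_pos by (simp add: mult_le_0_iff)
qed

lemma independent_mod_p_Cauchy_coeff:
  assumes indep: "independent_mod_p m u" and coeffs: "\<And>k. C k \<in> {..<m} \<rightarrow> Qp" and i_less: "i < m"
    and Cauchy_lincomb: "Cauchy (\<lambda>k. lincomb m (C k) u)"
  shows "Cauchy (\<lambda>k. C k i)"
proof (rule metric_CauchyI)
  fix e :: real assume "e > 0"
  then obtain N where lincomb_close: "\<And>k l. k \<ge> N \<Longrightarrow> l \<ge> N \<Longrightarrow>
      dist (lincomb m (C k) u) (lincomb m (C l) u) < absv \<p> * e"
    using metric_CauchyD[OF Cauchy_lincomb] absv_p_pos by (meson mult_pos_pos)
  have "dist (C k i) (C l i) < e" if "k \<ge> N" "l \<ge> N" for k l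
  proof -
    have "absv \<p> * dist (C k i) (C l i) \<le> dist (lincomb m (C k) u) (lincomb m (C l) u)"
      using independent_mod_p_absv_coeff_le[OF indep _ i_less, of "\<lambda>i. C k i - C l i"]
        coeffs Qp.K_closed(6)
      by (simp add: dist_absv sum_subtractf left_diff_distrib Pi_iff)
    then have "absv \<p> * dist (C k i) (C l i) < absv \<p> * e"
      using lincomb_close[OF that] by simp
    then show ?thesis using absv_p_pos by (meson mult_less_cancel_left_pos)
  qed
  then show "\<exists>N. \<forall>k\<ge>N. \<forall>l\<ge>N. dist (C k i) (C l i) < e" by blast
qed

lemma independent_mod_p_limit_in_span:
  assumes indep: "independent_mod_p m u" and coeffs: "\<And>k. C k \<in> {..<m} \<rightarrow> Qp"
    and lim: "(\<lambda>k. lincomb m (C k) u) \<longlonglongrightarrow> x"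
  shows "\<exists>c \<in> {..<m} \<rightarrow> Qp. x = lincomb m c u"
proof -
  have "\<exists>L\<in>Qp. (\<lambda>k. C k i) \<longlonglongrightarrow> L" if i_less: "i < m" for i
  proof -
    have "complete Qp" using padic_numbers unfolding padic_numbers_def by blast
    moreover have "C k i \<in> Qp" for k using coeffs i_less by auto
    ultimately show ?thesis
      using independent_mod_p_Cauchy_coeff[OF indep coeffs i_less LIMSEQ_imp_Cauchy[OF lim]]
      by (elim completeE) auto
  qed
  then obtain c where coeff_limit: "\<And>i. i < m \<Longrightarrow> c i \<in> Qp \<and> (\<lambda>k. C k i) \<longlonglongrightarrow> c i"
    by metis
  then have "(\<lambda>k. lincomb m (C k) u) \<longlonglongrightarrow> lincomb m c u"
    by (intro tendsto_intros) auto
  then have "x = lincomb m c u"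
    using lim LIMSEQ_unique by blast
  with coeff_limit show ?thesis by (intro bexI[of _ c]) auto
qed

lemma independent_mod_p_digits_unique:
  assumes indep: "independent_mod_p m u"
    and digits: "k \<in> {..<m} \<rightarrow>\<^sub>E {..<p}" "l \<in> {..<m} \<rightarrow>\<^sub>E {..<p}"
    and close: "dist (lincomb m (of_nat \<circ> k) u) (lincomb m (of_nat \<circ> l) u) \<le> absv \<p>"
  shows "k = l"
proof -
  define c :: "nat \<Rightarrow> 'a" where "c i = of_nat (k i) - of_nat (l i)" for i
  have "absv (lincomb m c u) \<le> absv \<p>"
    using close by (simp add: c_def dist_absv sum_subtractf left_diff_distrib)
  moreover have "c \<in> {..<m} \<rightarrow> Zp"
    using of_nat_in_Zp by (auto simp: c_def intro!: Qp.integer_diff)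
  ultimately have "absv (c i) \<le> absv \<p>" if "i < m" for i
    using independent_mod_pD[OF indep _ _ that] by blast
  then have "dist (of_nat (k i)) (of_nat (l i) :: 'a) \<le> absv \<p>" if "i < m" for i
    using that by (simp add: c_def dist_absv)
  then show ?thesis
    using digits by (intro PiE_ext[OF digits] dist_of_nat_le_absv_p_imp_eq) auto
qed

text \<open>A maximal family that is independent modulo \<open>p\<close> is a basis: it generates \<open>\<O>\<close> modulo \<open>p\<close> by
  maximality, hence modulo every \<open>p ^ k\<close>, hence exactly by completeness.\<close>

context
  fixes m :: nat and u :: "nat \<Rightarrow> 'a"
  assumes indep: "independent_mod_p m u" and maximal: "\<And>v. \<not> independent_mod_p (Suc m) v"
begin

lemma maximal_family_in_integers: "u \<in> {..<m} \<rightarrow> \<O>"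
  using indep by (simp add: independent_mod_p_def)

lemma maximal_family_relation_mod_pE:
  assumes x_integer: "x \<in> \<O>"
  obtains c where "c \<in> {..<m} \<rightarrow> Zp" "c m \<in> Zp" "absv (c m) = 1"
    "absv (lincomb m c u + c m * x) \<le> absv \<p>"
proof -
  have "u(m := x) \<in> {..<Suc m} \<rightarrow> \<O>"
    using maximal_family_in_integers x_integer by (auto simp: less_Suc_eq)
  then obtain c where "c \<in> {..<Suc m} \<rightarrow> Zp"
    and "absv (lincomb (Suc m) c (u(m := x))) \<le> absv \<p>"
    and nontrivial: "\<not> (\<forall>i<Suc m. absv (c i) \<le> absv \<p>)"
    using maximal[of "u(m := x)"] unfolding independent_mod_p_def by blast
  then have c_in: "c \<in> {..<m} \<rightarrow> Zp" "c m \<in> Zp"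
    and relation: "absv (lincomb m c u + c m * x) \<le> absv \<p>"
    by auto
  have "absv \<p> < absv (c m)"
  proof (rule ccontr)
    assume last_small: "\<not> ?thesis"
    then have "absv (c m * x) \<le> absv \<p>"
      using x_integer mult_mono[of "absv (c m)" "absv \<p>" "absv x" 1]
      by (simp add: absv_mult integer_iff)
    then have "absv (lincomb m c u) \<le> absv \<p>"
      using absv_add_le[of "lincomb m c u + c m * x" "- (c m * x)"] relation by simp
    then have "\<forall>i<m. absv (c i) \<le> absv \<p>"
      using independent_mod_pD[OF indep c_in(1)] by blast
    with last_small nontrivial show False by (auto simp: less_Suc_eq)
  qed
  then have "absv (c m) = 1"
    by (rule Zp_absv_eq_1_if_gt_absv_p[OF c_in(2)])
  with c_in show thesis using relation by (rule that)
qed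

lemma maximal_family_generates_mod_p:
  assumes x_integer: "x \<in> \<O>"
  shows "\<exists>c \<in> {..<m} \<rightarrow> Zp. dist x (lincomb m c u) \<le> absv \<p>"
proof -
  obtain c where coeffs: "c \<in> {..<m} \<rightarrow> Zp" "c m \<in> Zp" and unit: "absv (c m) = 1"
    and relation: "absv (lincomb m c u + c m * x) \<le> absv \<p>"
    by (rule maximal_family_relation_mod_pE[OF x_integer])
  define d where "d i = - (c i / c m)" for i
  have "c m \<noteq> 0" using unit by auto
  have "lincomb m d u = - (lincomb m c u / c m)"
    by (simp add: d_def sum_negf sum_divide_distrib)
  then have "x - lincomb m d u = (lincomb m c u + c m * x) / c m"
    using \<open>c m \<noteq> 0\<close> by (simp add: field_simps)
  then have "dist x (lincomb m d u) \<le> absv \<p>"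
    using relation unit by (simp add: dist_absv absv_divide)
  moreover have "d i \<in> Zp" if "i < m" for i
  proof -
    have "c i \<in> Zp" using coeffs that by auto
    then show ?thesis
      using coeffs(2) unit unfolding d_def
      by (intro Qp.integer_uminus Qp.integer_divide) (auto simp: Qp.integer_iff)
  qed
  ultimately show ?thesis by (intro bexI[of _ d]) auto
qed

lemma maximal_family_digits:
  assumes "x \<in> \<O>"
  shows "\<exists>k \<in> {..<m} \<rightarrow>\<^sub>E {..<p}. dist x (lincomb m (of_nat \<circ> k) u) \<le> absv \<p>"
proof -
  obtain c where approx: "c \<in> {..<m} \<rightarrow> Zp" "dist x (lincomb m c u) \<le> absv \<p>"
    using maximal_family_generates_mod_p[OF assms] by blast
  have "\<exists>k<p. dist (c i) (of_nat k) \<le> absv \<p>" if "i < m" for i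
    using approx(1) that Zp_near_natE by (metis PiE lessThan_iff)
  then obtain k where digit: "\<And>i. i < m \<Longrightarrow> k i < p \<and> dist (c i) (of_nat (k i)) \<le> absv \<p>"
    by metis
  then have "dist (lincomb m c u) (lincomb m (of_nat \<circ> restrict k {..<m}) u) \<le> absv \<p>"
    using maximal_family_in_integers by (intro dist_lincomb_le) auto
  then have "dist x (lincomb m (of_nat \<circ> restrict k {..<m}) u) \<le> absv \<p>"
    by (rule dist_le_trans[OF approx(2)])
  then show ?thesis
    using digit by (intro bexI[of _ "restrict k {..<m}"]) auto
qed

lemma maximal_family_generates_mod_p_power:
  assumes "x \<in> \<O>"
  shows "\<exists>c \<in> {..<m} \<rightarrow> Zp. dist x (lincomb m c u) \<le> absv \<p> ^ k"
  using assms
proof (induction k arbitrary: x)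
  case 0
  then show ?case
    by (intro bexI[of _ "\<lambda>_. 0"]) (auto simp: integer_iff absv_conv_dist Qp.integer_zero)
next
  case (Suc k)
  have "\<p> \<noteq> 0" using p_gt_1 by simp
  obtain c where approx: "c \<in> {..<m} \<rightarrow> Zp" "dist x (lincomb m c u) \<le> absv \<p>"
    using maximal_family_generates_mod_p[OF Suc.prems] by blast
  define y where "y = (x - lincomb m c u) / \<p>"
  have "x - lincomb m c u \<in> \<O>"
    using Suc.prems lincomb_in_integers[OF maximal_family_in_integers approx(1)]
    by (rule integer_diff)
  then have "y \<in> \<O>"
    using approx(2) K_closed(10) unfolding y_def
    by (intro integer_divide) (auto simp: integer_iff dist_absv)
  then obtain d where approx_quotient: "d \<in> {..<m} \<rightarrow> Zp" "dist y (lincomb m d u) \<le> absv \<p> ^ k"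
    using Suc.IH by blast
  have "lincomb m (\<lambda>i. c i + \<p> * d i) u = lincomb m c u + \<p> * lincomb m d u"
    by (simp add: distrib_right sum.distrib sum_distrib_left mult.assoc)
  moreover have "\<p> * y = x - lincomb m c u"
    using \<open>\<p> \<noteq> 0\<close> by (simp add: y_def)
  ultimately have "x - lincomb m (\<lambda>i. c i + \<p> * d i) u = \<p> * (y - lincomb m d u)"
    by (simp add: right_diff_distrib)
  then have "dist x (lincomb m (\<lambda>i. c i + \<p> * d i) u) \<le> absv \<p> ^ Suc k"
    using approx_quotient(2) by (simp add: dist_absv absv_mult mult_left_mono)
  moreover have "(\<lambda>i. c i + \<p> * d i) \<in> {..<m} \<rightarrow> Zp"
    using approx(1) approx_quotient(1) of_nat_in_Zp by (auto intro!: Qp.integer_add Qp.integer_mult)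
  ultimately show ?case by (intro bexI)
qed

lemma maximal_family_spans_integers:
  assumes "x \<in> \<O>"
  shows "\<exists>c \<in> {..<m} \<rightarrow> Qp. x = lincomb m c u"
proof -
  obtain C where approx: "\<And>k. C k \<in> {..<m} \<rightarrow> Zp"
    "\<And>k. dist x (lincomb m (C k) u) \<le> absv \<p> ^ k"
    using maximal_family_generates_mod_p_power[OF assms] by metis
  have "(\<lambda>k. lincomb m (C k) u) \<longlonglongrightarrow> x"
  proof (rule metric_tendsto_imp_tendsto)
    show "(\<lambda>k. absv \<p> ^ k) \<longlonglongrightarrow> 0"
      using absv_p_less_1 by (intro LIMSEQ_power_zero) simp
  qed (use approx(2) in \<open>simp add: dist_commute\<close>)
  moreover have "C k \<in> {..<m} \<rightarrow> Qp" for k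
    using approx(1)[of k] by (auto simp: Qp.integer_iff)
  ultimately show ?thesis
    using independent_mod_p_limit_in_span[OF indep] by blast
qed

lemma maximal_family_spans:
  assumes x_in_K: "x \<in> K"
  shows "\<exists>c \<in> {..<m} \<rightarrow> Qp. x = lincomb m c u"
proof -
  have "(\<lambda>k. absv (\<p> ^ k * x)) \<longlonglongrightarrow> 0"
    using absv_p_less_1 unfolding absv_mult absv_power
    by (intro tendsto_mult_left_zero LIMSEQ_power_zero) simp
  then have "\<forall>\<^sub>F k in sequentially. absv (\<p> ^ k * x) < 1"
    by (rule order_tendstoD) simp
  then obtain k where "absv (\<p> ^ k * x) < 1"
    by (auto simp: eventually_sequentially)
  then have "\<p> ^ k * x \<in> \<O>"
    using x_in_K K_closed by (simp add: integer_iff)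
  then obtain c where coeffs: "c \<in> {..<m} \<rightarrow> Qp" "\<p> ^ k * x = lincomb m c u"
    using maximal_family_spans_integers by blast
  have "x = lincomb m c u / \<p> ^ k"
    using p_gt_1 by (simp add: field_simps flip: coeffs(2))
  then have "x = lincomb m (\<lambda>i. c i / \<p> ^ k) u"
    by (simp add: sum_divide_distrib)
  moreover have "(\<lambda>i. c i / \<p> ^ k) \<in> {..<m} \<rightarrow> Qp"
    using coeffs(1) by (auto intro!: Qp.K_closed(8-10))
  ultimately show ?thesis by (rule bexI)
qed

lemma maximal_family_card_eq_dimension: "m = n"
proof (rule lin_independent_spanning_eq_dimension[OF Qp.subfield_K dimension_K])
  show "lin_independent Qp m u"
    using indep by (rule independent_mod_p_imp_lin_independent)
  show "u \<in> {..<m} \<rightarrow> K"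
    using maximal_family_in_integers by (auto simp: integer_iff)
  then have "(\<lambda>c. lincomb m c u) ` ({..<m} \<rightarrow> Qp) \<subseteq> K"
    using Qp_subset by (auto intro!: K_closed(4,11))
  then show "(\<lambda>c. lincomb m c u) ` ({..<m} \<rightarrow> Qp) = K"
    using maximal_family_spans by blast
qed

lemma residue_index_p_eq_power_card_maximal_family: "residue_index (absv \<p>) = p ^ m"
proof -
  have "residue_index (absv \<p>) = card ({..<m} \<rightarrow>\<^sub>E {..<p})"
  proof (rule residue_index_eq_card[where g = "\<lambda>k. lincomb m (of_nat \<circ> k) u"])
    show "lincomb m (of_nat \<circ> k) u \<in> \<O>" for k
      using maximal_family_in_integers of_nat_in_Zp by (intro lincomb_in_integers) auto
  qed (use maximal_family_digits independent_mod_p_digits_unique[OF indep] in auto)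
  then show ?thesis by (simp add: card_PiE)
qed

end

lemma residue_index_p: "residue_index (absv \<p>) = p ^ n"
proof -
  have bounded: "m \<le> n" if indep: "independent_mod_p m u" for m u
  proof -
    have "u \<in> {..<m} \<rightarrow> K"
      using indep by (auto simp: independent_mod_p_def integer_iff)
    then show ?thesis
      by (rule lin_independent_le_dimension[OF Qp.subfield_K dimension_K
            independent_mod_p_imp_lin_independent[OF indep]])
  qed
  have "independent_mod_p 0 u" for u
    by (simp add: independent_mod_p_def)
  then have "\<exists>m. (\<exists>u. independent_mod_p m u) \<and> (\<forall>k. (\<exists>u. independent_mod_p k u) \<longrightarrow> k \<le> m)"
    using bounded by (intro Nat.ex_has_greatest_nat[of _ 0 n]) blast+
  then obtain m u where indep: "independent_mod_p m u" "\<And>v. \<not> independent_mod_p (Suc m) v"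
    by (metis Suc_n_not_le_n)
  show ?thesis
    using maximal_family_card_eq_dimension[OF indep]
      residue_index_p_eq_power_card_maximal_family[OF indep] by simp
qed

lemma nontrivially_valued: "\<exists>x\<in>K. x \<noteq> 0 \<and> absv x < 1"
  using K_closed(10) absv_p_pos absv_p_less_1 by (intro bexI[of _ \<p>]) auto

lemma uniformizer_exists_in_extension: "\<exists>\<pi>. uniformizer \<pi>"
  using uniformizer_exists[of "of_nat p"] K_closed(10) p_gt_1 absv_p_less_1 residue_index_p
  by simp

lemma residue_index_times_absv_power:
  assumes "absv \<p> = real p powr (- real d)" "n = d * r" "x \<in> \<O>" "x \<noteq> 0"
  shows "real (residue_index (absv x)) * absv x ^ r = 1"
proof -
  obtain \<pi> where "uniformizer \<pi>"
    using uniformizer_exists_in_extension ..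
  then interpret discretely_valued_subfield K \<pi>
    by unfold_locales
  have "absv \<p> ^ r = inverse (real p ^ n)"
    using p_gt_1 assms(1,2) by (simp add: powr_minus powr_realpow power_inverse flip: power_mult)
  then have "real (residue_index (absv \<p>)) * absv \<p> ^ r = 1"
    using p_gt_1 by (simp add: residue_index_p)
  then show ?thesis
    using residue_index_times_absv_power_eq_1[OF _ _ absv_p_less_1 _ assms(3,4)]
      absv_of_nat_le_1 K_closed(10) p_gt_1
    by (simp add: integer_iff)
qed

end

lemma finite_extension_degree_trans:
  assumes "finite_extension_degree E F d" "finite_extension_degree F K r"
  shows "finite_extension_degree E K (d * r)"
proof -
  interpret R: ring "ambient :: 'a::abs_valued_field ring" by rule
  show ?thesis
    using assms R.telescopic_base[of E F d r K] by (auto simp: finite_extension_degree_def)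
qed

lemma (in padic_field) padic_extensionI:
  assumes "finite_extension_degree Qp K n"
  shows "padic_extension p Qp K n"
proof (intro padic_extension.intro ultrametric_subfield.intro padic_extension_axioms.intro)
  show "absv (x + y) \<le> max (absv x) (absv y)" for x y :: 'a
    by (rule Qp.absv_add_le)
qed (use assms padic_field_axioms in \<open>auto simp: finite_extension_degree_def\<close>)

section \<open>Counting simple zeros\<close>

lemma at_within_eq_if_openin:
  assumes "openin (top_of_set S) U" "a \<in> U"
  shows "at a within U = at a within S"
proof -
  obtain T where "open T" "U = S \<inter> T"
    using assms(1) by (auto simp: openin_open)
  then show ?thesis
    using assms(2) by (intro at_within_nhd[of a T]) auto
qed

locale simple_zeros = ultrametric_subfield K
  for K :: "'a::abs_valued_field set" +
  fixes U :: "'a set" and f f' :: "'a \<Rightarrow> 'a"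
  assumes nontrivially_valued: "\<exists>x\<in>K. x \<noteq> 0 \<and> absv x < 1"
    and compact_U: "compact U" and openin_U: "openin (top_of_set K) U"
    and f_in: "f \<in> U \<rightarrow> K"
    and strict_derivative: "has_strict_derivative_on f f' U"
    and simple: "\<forall>x\<in>U. (f x, f' x) \<noteq> (0, 0)"
begin

lemma U_subset: "U \<subseteq> K"
  using openin_U by (rule openin_imp_subset)

lemmas at_within_U = at_within_eq_if_openin[OF openin_U]

lemma at_within_U_neq_bot:
  assumes a_in_U: "a \<in> U"
  shows "at a within U \<noteq> bot"
proof -
  obtain z where z_nonunit: "z \<in> K" "z \<noteq> 0" "absv z < 1"
    using nontrivially_valued by blast
  have "\<exists>x\<in>K. x \<noteq> a \<and> dist x a < e" if e_pos: "e > 0" for e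
  proof -
    obtain k where "absv z ^ k < e"
      using real_arch_pow_inv[OF e_pos z_nonunit(3)] by blast
    moreover have "a + z ^ k \<in> K"
      using a_in_U U_subset z_nonunit(1) by (auto intro: K_closed)
    ultimately show ?thesis
      using z_nonunit(2) by (intro bexI[of _ "a + z ^ k"]) (auto simp: dist_absv absv_power)
  qed
  then show ?thesis
    unfolding at_within_U[OF a_in_U] trivial_limit_within islimpt_approachable by blast
qed

lemma continuous_on_f: "continuous_on U f"
  using strict_derivative by (rule has_strict_derivative_on_imp_continuous_on)

lemma continuous_on_f': "continuous_on U f'"
  using strict_derivative at_within_U_neq_bot
  by (rule has_strict_derivative_on_imp_continuous_on_derivative)

lemma eventually_absv_slope_eq:
  assumes "a \<in> U" "f' a \<noteq> 0"
  shows "\<forall>\<^sub>F x in at a within U. absv ((f x - f a) / (x - a)) = absv (f' a)"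
  using has_strict_derivative_on_imp_tendsto_slope[OF strict_derivative assms(1)] assms(2)
  by (rule eventually_absv_eq_of_tendsto)

lemma absv_derivative_in_value_groupE:
  assumes a_in_U: "a \<in> U" and "f' a \<noteq> 0"
  obtains b where "b \<in> K" "absv b = absv (f' a)"
proof -
  have "\<forall>\<^sub>F x in at a within U. x \<in> U"
    by (simp add: eventually_at_filter)
  with eventually_absv_slope_eq[OF assms]
  have "\<forall>\<^sub>F x in at a within U. absv ((f x - f a) / (x - a)) = absv (f' a) \<and> x \<in> U"
    by eventually_elim simp
  then obtain x where slope_eq: "absv ((f x - f a) / (x - a)) = absv (f' a)" and "x \<in> U"
    using eventually_happens'[OF at_within_U_neq_bot[OF a_in_U]] by blast
  have "(f x - f a) / (x - a) \<in> K"
    using \<open>x \<in> U\<close> a_in_U f_in U_subset by (intro K_closed(6,8)) auto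
  then show thesis using slope_eq by (rule that)
qed

definition zeros :: "'a set" where
  "zeros = {x \<in> U. f x = 0}"

lemma zerosD:
  assumes "a \<in> zeros"
  shows "a \<in> U" "a \<in> K" "f a = 0" "f' a \<noteq> 0"
  using assms simple U_subset by (auto simp: zeros_def)

definition scaled_at :: "'a \<Rightarrow> 'a \<Rightarrow> bool" where
  "scaled_at a x \<longleftrightarrow>
     x \<in> U \<and> absv (f x) = absv (f' a) * dist x a \<and> absv (f' x) = absv (f' a)"

lemma eventually_scaled_at_zero:
  assumes a_zero: "a \<in> zeros"
  shows "\<forall>\<^sub>F x in at a within K. scaled_at a x"
proof -
  have "\<forall>\<^sub>F x in at a within U. absv (f' x) = absv (f' a)"
    using continuous_on_f' zerosD[OF a_zero]
    by (intro eventually_absv_eq_of_tendsto) (auto simp: continuous_on)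
  moreover have "\<forall>\<^sub>F x in at a within U. x \<in> U \<and> x \<noteq> a"
    by (simp add: eventually_at_filter)
  moreover note eventually_absv_slope_eq[OF zerosD(1,4)[OF a_zero]]
  ultimately have "\<forall>\<^sub>F x in at a within U. scaled_at a x"
    by eventually_elim
      (auto simp: scaled_at_def zerosD(3)[OF a_zero] absv_divide dist_absv nonzero_divide_eq_eq)
  then show ?thesis by (simp add: at_within_U[OF zerosD(1)[OF a_zero]])
qed

lemma eq_if_scaled_at_zero:
  assumes "a \<in> zeros" "b \<in> zeros" "scaled_at b a"
  shows "a = b"
  using assms zerosD(3,4) by (simp add: scaled_at_def)

lemma eventually_nonzero:
  assumes a_in_U: "a \<in> U"
  shows "\<forall>\<^sub>F x in at a within U. f x \<noteq> 0"
proof (cases "f a = 0")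
  case True
  with a_in_U have zero: "a \<in> zeros" by (simp add: zeros_def)
  then have "\<forall>\<^sub>F x in at a within U. scaled_at a x"
    using eventually_scaled_at_zero by (simp add: at_within_U[OF a_in_U])
  moreover have "\<forall>\<^sub>F x in at a within U. x \<in> U \<and> x \<noteq> a"
    by (simp add: eventually_at_filter)
  ultimately show ?thesis
    by eventually_elim (use eq_if_scaled_at_zero[OF _ zero] in \<open>auto simp: zeros_def\<close>)
next
  case False
  then have "\<forall>\<^sub>F x in at a within U. absv (f x) = absv (f a)"
    using continuous_on_f a_in_U by (intro eventually_absv_eq_of_tendsto) (auto simp: continuous_on)
  then show ?thesis
    by eventually_elim (use False in auto)
qed

lemma finite_zeros: "finite zeros"
proof (rule ccontr)
  assume "infinite zeros"
  moreover have "zeros \<subseteq> U" by (auto simp: zeros_def)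
  ultimately obtain a where a_limit: "a \<in> U" "a islimpt zeros"
    using Heine_Borel_imp_Bolzano_Weierstrass[OF compact_U] by blast
  have "\<forall>\<^sub>F x in at a within zeros. f x \<noteq> 0"
    using eventually_nonzero[OF a_limit(1)] at_le[OF \<open>zeros \<subseteq> U\<close>] by (rule filter_leD[rotated])
  then have "\<forall>\<^sub>F x in at a within zeros. False"
    by (auto simp: eventually_at_filter zeros_def elim: eventually_mono)
  then show False
    using a_limit(2) by (simp add: trivial_limit_within)
qed

lemma scaling_radiusE:
  obtains \<delta> where "\<delta> > 0"
    "\<And>a x. a \<in> zeros \<Longrightarrow> x \<in> K \<Longrightarrow> dist x a < \<delta> \<Longrightarrow> scaled_at a x"
proof -
  have "\<forall>\<^sub>F \<delta> in at_right 0. \<forall>x\<in>K. dist x a < \<delta> \<longrightarrow> scaled_at a x" if a_zero: "a \<in> zeros" for a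
  proof -
    have "scaled_at a a" using zerosD[OF a_zero] by (simp add: scaled_at_def)
    then obtain \<delta> where "\<delta> > 0" "\<forall>x\<in>K. dist x a < \<delta> \<longrightarrow> scaled_at a x"
      using eventually_scaled_at_zero[OF a_zero] by (metis eventually_at)
    then show ?thesis
      by (force simp: eventually_at_right_field)
  qed
  then have "\<forall>\<^sub>F \<delta> in at_right (0::real). \<forall>a\<in>zeros. \<forall>x\<in>K. dist x a < \<delta> \<longrightarrow> scaled_at a x"
    using finite_zeros by (simp add: eventually_ball_finite)
  then show thesis
    using that by (auto simp: eventually_at_right_field dest: dense)
qed

lemma lower_bound_away_from_zerosE:
  assumes "\<delta> > 0"
  obtains \<epsilon> where "\<epsilon> > 0"
    "\<And>x. x \<in> U \<Longrightarrow> absv (f x) < \<epsilon> \<Longrightarrow> \<exists>a\<in>zeros. dist x a < \<delta>"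
proof -
  define C where "C = U - (\<Union>a\<in>zeros. ball a \<delta>)"
  have C_compl: "\<exists>a\<in>zeros. dist x a < \<delta>" if "x \<in> U" "x \<notin> C" for x
    using that by (auto simp: C_def dist_commute)
  have "compact C"
    unfolding C_def by (intro compact_diff compact_U open_UN) auto
  have "continuous_on C (\<lambda>x. absv (f x))"
    unfolding C_def by (intro continuous_intros continuous_on_subset[OF continuous_on_f]) auto
  show thesis
  proof (cases "C = {}")
    case True
    then show thesis using that[of 1] C_compl by simp
  next
    case False
    obtain x where x_minimal: "x \<in> C" "\<And>y. y \<in> C \<Longrightarrow> absv (f x) \<le> absv (f y)"
      using continuous_attains_inf[OF \<open>compact C\<close> False \<open>continuous_on C _\<close>] by blast
    have "x \<in> U" "x \<notin> zeros" using x_minimal(1) assms by (auto simp: C_def)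
    then have "absv (f x) > 0" by (simp add: zeros_def)
    then show thesis
      by (rule that) (use C_compl x_minimal(2) not_less in blast)
  qed
qed

abbreviation zero_disc :: "real \<Rightarrow> 'a \<Rightarrow> 'a set" where
  "zero_disc \<epsilon> a \<equiv> disc a (\<epsilon> / absv (f' a))"

lemma zero_disc_iff_if_scaled_at:
  assumes "a \<in> zeros" "scaled_at a x"
  shows "x \<in> zero_disc \<epsilon> a \<longleftrightarrow> absv (f x) \<le> \<epsilon>"
  using assms zerosD(4)[OF assms(1)] U_subset
  by (auto simp: scaled_at_def disc_def field_simps)

lemma sublevel_eq_Union_zero_disc:
  assumes scaled: "\<And>a x. a \<in> zeros \<Longrightarrow> x \<in> zero_disc \<epsilon> a \<Longrightarrow> scaled_at a x"
    and near_zero: "\<And>x. x \<in> U \<Longrightarrow> absv (f x) \<le> \<epsilon> \<Longrightarrow> \<exists>a\<in>zeros. scaled_at a x"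
  shows "{x \<in> U. absv (f x) \<le> \<epsilon>} = (\<Union>a\<in>zeros. zero_disc \<epsilon> a)"
proof (intro equalityI subsetI)
  fix x assume x_sublevel: "x \<in> {x \<in> U. absv (f x) \<le> \<epsilon>}"
  then obtain a where "a \<in> zeros" "scaled_at a x" using near_zero by blast
  then show "x \<in> (\<Union>a\<in>zeros. zero_disc \<epsilon> a)"
    using x_sublevel zero_disc_iff_if_scaled_at by blast
next
  fix x assume "x \<in> (\<Union>a\<in>zeros. zero_disc \<epsilon> a)"
  then obtain a where x_in_disc: "a \<in> zeros" "x \<in> zero_disc \<epsilon> a" by blast
  then have "scaled_at a x" by (rule scaled)
  with x_in_disc show "x \<in> {x \<in> U. absv (f x) \<le> \<epsilon>}"
    using zero_disc_iff_if_scaled_at by (simp add: scaled_at_def)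
qed

lemma disjoint_family_on_zero_disc:
  assumes scaled: "\<And>a x. a \<in> zeros \<Longrightarrow> x \<in> K \<Longrightarrow> dist x a < \<delta> \<Longrightarrow> scaled_at a x"
    and radius_less: "\<And>a. a \<in> zeros \<Longrightarrow> \<epsilon> / absv (f' a) < \<delta>"
  shows "disjoint_family_on (zero_disc \<epsilon>) zeros"
  unfolding disjoint_family_on_def
proof (intro ballI impI equals0I)
  fix a b x assume distinct_zeros: "a \<in> zeros" "b \<in> zeros" "a \<noteq> b"
    and "x \<in> zero_disc \<epsilon> a \<inter> zero_disc \<epsilon> b"
  then have "dist a x < \<delta>" "dist x b < \<delta>"
    using radius_less by (fastforce simp: disc_def dist_commute)+
  then have "dist a b < \<delta>"
    using dist_le_max[of a b x] by simp
  then show False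
    using scaled eq_if_scaled_at_zero distinct_zeros zerosD(2) by blast
qed

lemma eventually_sublevel_eq_zero_discs:
  "\<forall>\<^sub>F \<epsilon> in at_right 0. {x \<in> U. absv (f x) \<le> \<epsilon>} = (\<Union>a\<in>zeros. zero_disc \<epsilon> a) \<and>
     disjoint_family_on (zero_disc \<epsilon>) zeros \<and>
     (\<forall>a\<in>zeros. \<forall>x\<in>zero_disc \<epsilon> a. scaled_at a x)"
proof -
  obtain \<delta> where "\<delta> > 0"
    and scaled: "\<And>a x. a \<in> zeros \<Longrightarrow> x \<in> K \<Longrightarrow> dist x a < \<delta> \<Longrightarrow> scaled_at a x"
    using scaling_radiusE by metis
  obtain \<eta> where "\<eta> > 0"
    and near_zero: "\<And>x. x \<in> U \<Longrightarrow> absv (f x) < \<eta> \<Longrightarrow> \<exists>a\<in>zeros. dist x a < \<delta>"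
    using lower_bound_away_from_zerosE[OF \<open>\<delta> > 0\<close>] by blast
  have "\<forall>\<^sub>F \<epsilon> in at_right 0. \<epsilon> < \<eta> \<and> (\<forall>a\<in>zeros. \<epsilon> < absv (f' a) * \<delta>)"
    using \<open>\<eta> > 0\<close> \<open>\<delta> > 0\<close> finite_zeros zerosD(4)
    by (intro eventually_conj eventually_ball_finite ballI order_tendstoD(2)[OF tendsto_ident_at])
      auto
  then show ?thesis
  proof eventually_elim
    case (elim \<epsilon>)
    have radius_less: "\<epsilon> / absv (f' a) < \<delta>" if "a \<in> zeros" for a
      using elim that zerosD(4)[OF that] by (simp add: field_simps)
    have zero_disc_scaled: "scaled_at a x" if "a \<in> zeros" "x \<in> zero_disc \<epsilon> a" for a x
      using scaled[of a x] radius_less[OF that(1)] that by (simp add: disc_def)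
    have "{x \<in> U. absv (f x) \<le> \<epsilon>} = (\<Union>a\<in>zeros. zero_disc \<epsilon> a)"
    proof (rule sublevel_eq_Union_zero_disc[OF zero_disc_scaled])
      fix x assume "x \<in> U" "absv (f x) \<le> \<epsilon>"
      then show "\<exists>a\<in>zeros. scaled_at a x"
        using near_zero[of x] scaled U_subset elim by force
    qed
    moreover have "disjoint_family_on (zero_disc \<epsilon>) zeros"
      using scaled radius_less by (rule disjoint_family_on_zero_disc)
    ultimately show ?case using zero_disc_scaled by blast
  qed
qed

context
  fixes \<mu> :: "'a measure" and r :: nat
  assumes sets: "\<And>a t. disc a t \<in> sets \<mu>"
    and measure: "\<And>a b. a \<in> K \<Longrightarrow> b \<in> \<O> \<Longrightarrow> b \<noteq> 0 \<Longrightarrow> measure \<mu> (disc a (absv b)) = absv b ^ r"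
begin

lemma measure_zero_disc:
  assumes a_zero: "a \<in> zeros" and c_le: "c \<in> K" "c \<noteq> 0" "absv c \<le> absv (f' a)"
  shows "measure \<mu> (zero_disc (absv c) a) = (absv c / absv (f' a)) ^ r"
proof -
  obtain b where absv_b: "b \<in> K" "absv b = absv (f' a)"
    using absv_derivative_in_value_groupE zerosD(1,4)[OF a_zero] by metis
  then have "c / b \<in> \<O>" "c / b \<noteq> 0"
    using c_le zerosD(4)[OF a_zero] by (auto intro!: integer_divide)
  then show ?thesis
    using measure[OF zerosD(2)[OF a_zero]] by (metis absv_divide absv_b(2))
qed

lemma has_bochner_integral_zero_disc:
  assumes a_zero: "a \<in> zeros" and c_le: "c \<in> K" "c \<noteq> 0" "absv c \<le> absv (f' a)"
    and scaled: "\<And>x. x \<in> zero_disc (absv c) a \<Longrightarrow> scaled_at a x"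
  shows "has_bochner_integral \<mu> (\<lambda>x. indicator (zero_disc (absv c) a) x *\<^sub>R absv (f' x) ^ r)
    (absv c ^ r)"
proof -
  have "measure \<mu> (zero_disc (absv c) a) \<noteq> 0"
    using measure_zero_disc[OF a_zero c_le] c_le(2) zerosD(4)[OF a_zero] by simp
  then have "emeasure \<mu> (zero_disc (absv c) a) < \<infinity>"
    using measure_zero_top by (force simp: less_top)
  from has_bochner_integral_indicator[OF sets this, of "absv (f' a) ^ r"]
  have "has_bochner_integral \<mu> (\<lambda>x. indicator (zero_disc (absv c) a) x *\<^sub>R absv (f' a) ^ r)
      (absv c ^ r)"
    using zerosD(4)[OF a_zero] by (simp add: measure_zero_disc[OF a_zero c_le] power_divide)
  then show ?thesis
    using scaled by (subst has_bochner_integral_cong[OF refl _ refl])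
      (auto simp: indicator_def scaled_at_def)
qed

lemma eventually_set_integral_eq:
  "\<forall>\<^sub>F \<epsilon> in at_right 0. \<epsilon> \<in> absv ` K \<longrightarrow>
    (LINT x:U|\<mu>. absv (f' x) ^ r * indicator {x. absv (f x) \<le> \<epsilon>} x) = real (card zeros) * \<epsilon> ^ r"
proof -
  have "\<forall>\<^sub>F \<epsilon> in at_right (0::real). \<epsilon> > 0 \<and> (\<forall>a\<in>zeros. \<epsilon> < absv (f' a))"
    using finite_zeros zerosD(4)
    by (intro eventually_conj eventually_ball_finite eventually_at_right_less ballI
        order_tendstoD(2)[OF tendsto_ident_at]) auto
  with eventually_sublevel_eq_zero_discs show ?thesis
  proof eventually_elim
    case (elim \<epsilon>)
    show ?case
    proof
      assume "\<epsilon> \<in> absv ` K"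
      then obtain c where absv_c: "c \<in> K" "\<epsilon> = absv c" by blast
      have integral: "has_bochner_integral \<mu>
          (\<lambda>x. indicator (zero_disc \<epsilon> a) x *\<^sub>R absv (f' x) ^ r) (\<epsilon> ^ r)" if "a \<in> zeros" for a
        using elim that absv_c unfolding absv_c(2)
        by (intro has_bochner_integral_zero_disc) (auto intro: less_imp_le)
      have integrable: "set_integrable \<mu> (zero_disc \<epsilon> a) (\<lambda>x. absv (f' x) ^ r)"
        if "a \<in> zeros" for a
        unfolding set_integrable_def using integral[OF that] by (rule integrable.intros)
      have "(LINT x:U|\<mu>. absv (f' x) ^ r * indicator {x. absv (f x) \<le> \<epsilon>} x)
          = (LINT x:{x \<in> U. absv (f x) \<le> \<epsilon>}|\<mu>. absv (f' x) ^ r)"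
        unfolding set_lebesgue_integral_def
        by (intro Bochner_Integration.integral_cong refl) (simp add: indicator_def)
      also have "\<dots> = (\<Sum>a\<in>zeros. LINT x:zero_disc \<epsilon> a|\<mu>. absv (f' x) ^ r)"
        using elim integrable sets finite_zeros by (auto intro!: set_integral_finite_Union)
      also have "\<dots> = (\<Sum>a\<in>zeros. \<epsilon> ^ r)"
        unfolding set_lebesgue_integral_def
        using integral by (intro sum.cong refl has_bochner_integral_integral_eq)
      finally show "(LINT x:U|\<mu>. absv (f' x) ^ r * indicator {x. absv (f x) \<le> \<epsilon>} x)
          = real (card zeros) * \<epsilon> ^ r"
        by simp
    qed
  qed
qed

lemma card_zeros_limit:
  fixes q :: real
  assumes b_inverse: "b \<in> K" "q * absv b = 1" "absv b < 1"
  shows "(\<lambda>s::nat. q ^ (s * r) *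
       (LINT x:U|\<mu>. absv (f' x) ^ r * indicator {x. absv (f x) \<le> q powr (- real s)} x))
      \<longlonglongrightarrow> real (card zeros)"
proof -
  have "absv b > 0" using b_inverse(2) by (cases "b = 0") auto
  then have "q > 0" using b_inverse(2) by (metis zero_less_mult_pos2 zero_less_one)
  have powr_eq: "q powr (- real s) = absv b ^ s" for s
    using b_inverse(2) \<open>q > 0\<close>
    by (simp add: powr_minus powr_realpow inverse_unique flip: power_mult_distrib)
  have "filterlim (\<lambda>s. absv b ^ s) (at_right 0) sequentially"
    unfolding filterlim_at using b_inverse(3) \<open>absv b > 0\<close> by (auto intro: LIMSEQ_power_zero)
  from eventually_compose_filterlim[OF eventually_set_integral_eq this]
  have "\<forall>\<^sub>F s in sequentially. absv b ^ s \<in> absv ` K \<longrightarrow>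
      (LINT x:U|\<mu>. absv (f' x) ^ r * indicator {x. absv (f x) \<le> absv b ^ s} x)
        = real (card zeros) * (absv b ^ s) ^ r"
    by simp
  moreover have "absv b ^ s \<in> absv ` K" for s
    using b_inverse(1) K_closed(9) by (auto simp flip: absv_power)
  moreover have "q ^ (s * r) * (absv b ^ s) ^ r = 1" for s
    by (simp add: b_inverse(2) flip: power_mult power_mult_distrib)
  ultimately have "\<forall>\<^sub>F s in sequentially. q ^ (s * r) *
       (LINT x:U|\<mu>. absv (f' x) ^ r * indicator {x. absv (f x) \<le> q powr (- real s)} x)
      = real (card zeros)"
    unfolding powr_eq by (auto elim!: eventually_mono simp: mult.left_commute)
  then show ?thesis by (rule tendsto_eventually)
qed

end

end

theorem theorem1p1:
  fixes p q d r :: nat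
    and Qp F K U :: "'a::abs_valued_field set"
    and \<mu> :: "'a measure"
    and f f' :: "'a \<Rightarrow> 'a"
  assumes "Factorial_Ring.prime p"
    and "padic_numbers p Qp"
    and "finite_extension_degree Qp F d"
    and "card (carrier (residue_field F)) = q"
    and "algebraic_closure (ambient :: 'a ring) F"
    and "absv (of_nat p :: 'a) = real p powr (- real d)"
    and "finite_extension_degree F K r"
    and "haar_measure_on K \<mu>" and "emeasure \<mu> (integer_ring K) = 1"
    and "U \<subseteq> K" and "compact U" and "openin (top_of_set K) U"
    and "f \<in> U \<rightarrow> K"
    and "has_strict_derivative_on f f' U"
    and "\<forall>x\<in>U. (f x, f' x) \<noteq> (0, 0)"
  shows "finite {x \<in> U. f x = 0} \<and>
    (\<lambda>s::nat. real q ^ (s * r) *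
       (LINT x:U|\<mu>. absv (f' x) ^ r *
          indicator {x. absv (f x) \<le> real q powr (- real s)} x))
      \<longlonglongrightarrow> real (card {x \<in> U. f x = 0})"
proof -
  interpret padic_field p Qp
    using assms(1,2) by (rule padic_field.intro)
  interpret F: padic_extension p Qp F d
    using assms(3) by (rule padic_extensionI)
  interpret K: padic_extension p Qp K "d * r"
    using assms(3,7) by (intro padic_extensionI finite_extension_degree_trans)
  interpret K: simple_zeros K U f f'
    using K.nontrivially_valued assms(11-15) by unfold_locales
  obtain \<pi> where "F.uniformizer \<pi>"
    using F.uniformizer_exists_in_extension ..
  then interpret F: discretely_valued_subfield F \<pi>
    by unfold_locales
  have "\<pi> \<in> integer_ring F" "\<pi> \<in> K"
    using F.uniformizerD assms(7) by (auto simp: F.integer_iff finite_extension_degree_def)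
  then have "real q * absv \<pi> = 1"
    using F.residue_index_times_absv_power[OF assms(6), of 1 \<pi>] F.uniformizerD(2) assms(4)
    by (simp add: F.carrier_residue_field F.residue_index_def)
  moreover have "measure \<mu> (K.disc a (absv b)) = absv b ^ r"
    if "a \<in> K" "b \<in> integer_ring K" "b \<noteq> 0" for a b
    using K.measure_disc[OF assms(8,9)] K.residue_index_times_absv_power[OF assms(6) refl] that
    by blast
  ultimately show ?thesis
    using K.card_zeros_limit[OF K.disc_in_sets[OF assms(8)]] K.finite_zeros \<open>\<pi> \<in> K\<close>
      F.uniformizerD(3)
    unfolding K.zeros_def by blast
qed

end
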